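(* Let $S=\{i_0,\dots,i_{K-1}\}\subset\{0,\dots,\ell\}$ with $|S|=K$, let $\pi^0$ be a probability measure on $(\mathbb{R}^d)^{\ell+1}$ and let $\{\mu_i\}_{i\in S}$ be probability measures on $\mathbb{R}^d$. Assume the following. (A2) There exists a family of measures $\{\nu_i\}_{i\in\{0,\dots,\ell\}}$ on $(\mathbb{R}^d,\mathcal{B}(\mathbb{R}^d))$ such that $\pi^0\ll\bigotimes_{i=0}^\ell\nu_i$ with density $h=\mathrm{d}\pi^0/(\mathrm{d}\bigotimes_{i=0}^\ell\nu_i)$, and $\mu_i\ll\nu_i$ with density $r_i=\mathrm{d}\mu_i/\mathrm{d}\nu_i$ for any $i\in S$. (A3) The set $\{\pi : \mathrm{KL}(\pi\mid\pi^0)<\infty,\ \pi_i=\mu_i\ \forall i\in S\}$ of probability measures on $(\mathbb{R}^d)^{\ell+1}$ is non-empty. (A4) There exists a family of probability measures $\{\tilde\mu_j\}_{j\in\{0,\dots,\ell\}\setminus S}$ on $\mathbb{R}^d$ such that $\pi^0\sim\tilde\pi^0$ (mutual absolute continuity), where $\tilde\pi^0=\bigotimes_{i\in S}\mu_i\bigotimes_{j\in\{0,\dots,\ell\}\setminus S}\tilde\mu_j$. Let $\pi^\star$ be the unique minimizer of $\mathrm{KL}(\pi\mid\pi^0)$ over probability measures $\pi$ on $(\mathbb{R}^d)^{\ell+1}$ with $\pi_i=\mu_i$ for all $i\in S$. Let $(\pi^n)_{n\in\mathbb{N}}$ be the multi-marginal Iterative Proportional Fitting (mIPF) sequence started at $\pi^0$,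 and let $\{\psi^m_i\}_{m\in\mathbb{N},i\in S}$ be its potentials (both defined in the context). Assume moreover: (A5) $\bigoplus_{i\in S}L^1(\mu_i)\subset L^1(\pi^\star)$ is closed, where $\bigoplus_{i\in S}L^1(\mu_i)=\{x_{0:\ell}\mapsto\sum_{i\in S}f_i(x_i): f_i\in L^1(\mu_i)\}$. (A6) There exists $\bar c\in(0,\infty)$ such that $\exp(\psi^n_{i_k}-\psi^{n+1}_{i_k})\le\bar c$ for any $n\in\mathbb{N}$ and any $k\in\{0,\dots,K-2\}$. Then $\lim_{n\to\infty}\|\pi^n-\pi^\star\|_{\mathrm{TV}}=0$.
   Context: For a probability measure $\pi$ on $(\mathbb{R}^d)^{\ell+1}$, with coordinates $x_{0:\ell}=(x_0,\dots,x_\ell)$, $\pi_i$ denotes its $i$-th marginal on $\mathbb{R}^d$. For probability measures, $\mathrm{KL}(\mu\mid\nu)=\int\log(\mathrm{d}\mu/\mathrm{d}\nu)\,\mathrm{d}\mu$ if $\mu\ll\nu$ and $+\infty$ otherwise. $\mathbb{N}=\{0,1,\dots\}$, $\mathbb{N}^*=\mathbb{N}\setminus\{0\}$, and $\|\cdot\|_{\mathrm{TV}}$ is the total variation norm. Under (A2) and (A3), $\pi^\star$ exists and is unique. mIPF sequence: for every $n\in\mathbb{N}$, $\pi^{n+1}$ is the minimizer of $\mathrm{KL}(\pi\mid\pi^n)$ over probability measures $\pi$ on $(\mathbb{R}^d)^{\ell+1}$ with $\pi_{i_j}=\mu_{i_j}$, where $j=n \bmod K\in\{0,\dots,K-1\}$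 (so $\pi^1$ has the prescribed marginal at $i_0$, $\pi^2$ at $i_1$, etc., cyclically). Potentials: for $n\in\mathbb{N}^*$ write $n=q_nK+k_n+1$ with $k_n=(n-1)\bmod K$ and $q_n\in\mathbb{N}$. Under (A2)-(A4), the mIPF iterates can be written with measurable functions $\psi^m_i$ on $\mathbb{R}^d$ ($m\in\mathbb{N}$, $i\in S$), called potentials, in the sense that for every $n\in\mathbb{N}^*$, $$\frac{\mathrm{d}\pi^n}{\mathrm{d}\pi^0}(x_{0:\ell})=\exp\Big[\sum_{j=0}^{k_n}\psi^{q_n+1}_{i_j}(x_{i_j})+\sum_{j=k_n+1}^{K-1}\psi^{q_n}_{i_j}(x_{i_j})\Big]\quad\pi^0\text{-a.s.}$$ *)

theory Defs
  imports "HOL-Probability.Probability"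
begin

text \<open>Points of the path space over \<open>'a\<close> are the extensional functions
  on \<open>{0..l}\<close>. For second countable \<open>'a\<close> the product sigma-algebra is
  the Borel sigma-algebra of the product.\<close>

definition path_space :: "nat \<Rightarrow> (nat \<Rightarrow> 'a::topological_space) measure" where
  "path_space l = Pi\<^sub>M {0..l} (\<lambda>_. borel)"

definition prob_measures :: "'b measure \<Rightarrow> 'b measure set" where
  "prob_measures M = {\<mu>. prob_space \<mu> \<and> sets \<mu> = sets M}"

definition marginal :: "nat \<Rightarrow> (nat \<Rightarrow> 'a::topological_space) measure \<Rightarrow> 'a measure" where
  "marginal i \<pi> = distr \<pi> borel (\<lambda>x. x i)"

definition with_marginals ::
  "nat \<Rightarrow> nat set \<Rightarrow> (nat \<Rightarrow> 'a::topological_space measure) \<Rightarrow> (nat \<Rightarrow> 'a) measure set" where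
  "with_marginals l I \<mu> = {\<pi> \<in> prob_measures (path_space l). \<forall>i\<in>I. marginal i \<pi> = \<mu> i}"

text \<open>The library's \<^const>\<open>KL_divergence\<close> is real-valued, takes the reference measure first,
  and is meaningful only under absolute continuity and integrability of the log-density.
  For probability measures the negative part of \<open>log (d\<mu>/d\<nu>)\<close> is always \<open>\<mu>\<close>-integrable,
  so if \<open>\<mu> \<lless> \<nu>\<close> and integrability fails, then the integral is \<open>\<infinity>\<close>.\<close>

definition KL :: "'b measure \<Rightarrow> 'b measure \<Rightarrow> ereal" where
  "KL \<mu> \<nu> =
    (if absolutely_continuous \<nu> \<mu> \<and> integrable \<mu> (entropy_density (exp 1) \<nu> \<mu>)
     then ereal (KL_divergence (exp 1) \<nu> \<mu>) else \<infinity>)"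

definition is_KL_projection :: "'b measure set \<Rightarrow> 'b measure \<Rightarrow> 'b measure \<Rightarrow> bool" where
  "is_KL_projection C \<rho> \<pi> \<longleftrightarrow> is_arg_min (\<lambda>\<pi>'. KL \<pi>' \<rho>) (\<lambda>\<pi>'. \<pi>' \<in> C) \<pi>"

definition mIPF_sequence ::
  "nat \<Rightarrow> nat \<Rightarrow> (nat \<Rightarrow> nat) \<Rightarrow> (nat \<Rightarrow> 'a::topological_space measure) \<Rightarrow>
    (nat \<Rightarrow> 'a) measure \<Rightarrow> (nat \<Rightarrow> (nat \<Rightarrow> 'a) measure) \<Rightarrow> bool" where
  "mIPF_sequence l K \<iota> \<mu> \<pi>0 \<pi> \<longleftrightarrow>
    \<pi> 0 = \<pi>0 \<and>
    (\<forall>n. is_KL_projection (with_marginals l {\<iota> (n mod K)} \<mu>) (\<pi> n) (\<pi> (Suc n)))"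

text \<open>\<open>\<psi> m i\<close> is the \<open>m\<close>-th potential at coordinate \<open>i\<close>. If \<open>\<pi> n\<close> were not absolutely continuous
  with respect to \<open>\<pi> 0\<close>, then \<^const>\<open>RN_deriv\<close> would be constantly 0 and the equation below
  would fail, so absolute continuity is part of this definition.\<close>

definition mIPF_potentials ::
  "nat \<Rightarrow> (nat \<Rightarrow> nat) \<Rightarrow> (nat \<Rightarrow> (nat \<Rightarrow> 'a::topological_space) measure) \<Rightarrow>
    (nat \<Rightarrow> nat \<Rightarrow> 'a \<Rightarrow> real) \<Rightarrow> bool" where
  "mIPF_potentials K \<iota> \<pi> \<psi> \<longleftrightarrow>
    (\<forall>m. \<forall>i\<in>\<iota> ` {..<K}. \<psi> m i \<in> borel_measurable borel) \<and>
    (\<forall>n\<ge>1. let q = (n - 1) div K; k = (n - 1) mod K in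
      AE x in \<pi> 0. RN_deriv (\<pi> 0) (\<pi> n) x =
        ennreal (exp ((\<Sum>j\<in>{0..k}. \<psi> (q + 1) (\<iota> j) (x (\<iota> j))) +
                      (\<Sum>j\<in>{k+1..<K}. \<psi> q (\<iota> j) (x (\<iota> j))))))"

text \<open>\<open>L\<^sup>1\<close> as a metric space whose points are almost-everywhere classes of integrable functions.\<close>

definition L1_class :: "'b measure \<Rightarrow> ('b \<Rightarrow> real) \<Rightarrow> ('b \<Rightarrow> real) set" where
  "L1_class M f = {g. integrable M g \<and> (AE x in M. f x = g x)}"

definition L1_space :: "'b measure \<Rightarrow> ('b \<Rightarrow> real) set set" where
  "L1_space M = L1_class M ` {f. integrable M f}"

definition L1_dist :: "'b measure \<Rightarrow> ('b \<Rightarrow> real) set \<Rightarrow> ('b \<Rightarrow> real) set \<Rightarrow> real" where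
  "L1_dist M F G = (\<integral>x. \<bar>(SOME f. f \<in> F) x - (SOME g. g \<in> G) x\<bar> \<partial>M)"

lemma L1_rep:
  assumes "integrable M f"
  shows "integrable M (SOME g. g \<in> L1_class M f)"
    and "AE x in M. f x = (SOME g. g \<in> L1_class M f) x"
proof -
  have "f \<in> L1_class M f"
    using assms by (simp add: L1_class_def)
  then have "(SOME g. g \<in> L1_class M f) \<in> L1_class M f"
    by (rule someI[where P = "\<lambda>g. g \<in> L1_class M f"])
  then show "integrable M (SOME g. g \<in> L1_class M f)"
    and "AE x in M. f x = (SOME g. g \<in> L1_class M f) x"
    by (simp_all add: L1_class_def)
qed

lemma L1_dist_class:
  assumes f: "integrable M f" and g: "integrable M g"
  shows "L1_dist M (L1_class M f) (L1_class M g) = (\<integral>x. \<bar>f x - g x\<bar> \<partial>M)"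
  unfolding L1_dist_def
proof (rule integral_cong_AE)
  show "AE x in M. \<bar>(SOME h. h \<in> L1_class M f) x - (SOME h. h \<in> L1_class M g) x\<bar> = \<bar>f x - g x\<bar>"
    using L1_rep(2)[OF f] L1_rep(2)[OF g] by eventually_elim simp
qed (use f g L1_rep(1)[OF f] L1_rep(1)[OF g] in measurable)

lemma L1_class_eq_iff:
  assumes f: "integrable M f" and g: "integrable M g"
  shows "L1_class M f = L1_class M g \<longleftrightarrow> (AE x in M. f x = g x)"
proof
  assume "L1_class M f = L1_class M g"
  moreover have "g \<in> L1_class M g"
    using g by (simp add: L1_class_def)
  ultimately have "g \<in> L1_class M f"
    by simp
  then show "AE x in M. f x = g x"
    by (simp add: L1_class_def)
next
  assume eq: "AE x in M. f x = g x"
  have "(AE x in M. f x = h x) \<longleftrightarrow> (AE x in M. g x = h x)" for h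
  proof
    assume "AE x in M. f x = h x"
    with eq show "AE x in M. g x = h x" by eventually_elim simp
  next
    assume "AE x in M. g x = h x"
    with eq show "AE x in M. f x = h x" by eventually_elim simp
  qed
  then show "L1_class M f = L1_class M g"
    by (simp add: L1_class_def)
qed

lemma Metric_space_L1: "Metric_space (L1_space M) (L1_dist M)"
proof
  fix F G
  show "0 \<le> L1_dist M F G"
    by (simp add: L1_dist_def)
  show "L1_dist M F G = L1_dist M G F"
    by (simp add: L1_dist_def abs_minus_commute)
next
  fix F G assume "F \<in> L1_space M" "G \<in> L1_space M"
  then obtain f g where fg: "integrable M f" "integrable M g"
    and FG: "F = L1_class M f" "G = L1_class M g"
    by (auto simp: L1_space_def)
  have "(\<integral>x. \<bar>f x - g x\<bar> \<partial>M) = 0 \<longleftrightarrow> (AE x in M. \<bar>f x - g x\<bar> = 0)"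
    using fg by (intro integral_nonneg_eq_0_iff_AE) auto
  then show "L1_dist M F G = 0 \<longleftrightarrow> F = G"
    using fg by (simp add: FG L1_dist_class L1_class_eq_iff)
next
  fix F G H assume "F \<in> L1_space M" "G \<in> L1_space M" "H \<in> L1_space M"
  then obtain f g h where fgh: "integrable M f" "integrable M g" "integrable M h"
    and FGH: "F = L1_class M f" "G = L1_class M g" "H = L1_class M h"
    by (auto simp: L1_space_def)
  have "(\<integral>x. \<bar>f x - h x\<bar> \<partial>M) \<le> (\<integral>x. \<bar>f x - g x\<bar> + \<bar>g x - h x\<bar> \<partial>M)"
    using fgh by (intro integral_mono) auto
  also have "\<dots> = (\<integral>x. \<bar>f x - g x\<bar> \<partial>M) + (\<integral>x. \<bar>g x - h x\<bar> \<partial>M)"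
    using fgh by (intro Bochner_Integration.integral_add) auto
  finally show "L1_dist M F H \<le> L1_dist M F G + L1_dist M G H"
    using fgh by (simp add: FGH L1_dist_class)
qed

definition L1_closed :: "'b measure \<Rightarrow> ('b \<Rightarrow> real) set \<Rightarrow> bool" where
  "L1_closed M A \<longleftrightarrow>
    A \<subseteq> {f. integrable M f} \<and>
    closedin (Metric_space.mtopology (L1_space M) (L1_dist M)) (L1_class M ` A)"

definition L1_direct_sum ::
  "nat set \<Rightarrow> (nat \<Rightarrow> 'a measure) \<Rightarrow> ((nat \<Rightarrow> 'a) \<Rightarrow> real) set" where
  "L1_direct_sum I \<mu> = {(\<lambda>x. \<Sum>i\<in>I. f i (x i)) | f. \<forall>i\<in>I. integrable (\<mu> i) (f i)}"

text \<open>Total variation norm of the signed measure \<open>\<mu> - \<nu>\<close>, for finite measures \<open>\<mu>\<close>, \<open>\<nu>\<close> on the same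
  sigma-algebra (so the real supremum is over a set bounded by the two total masses). For
  probability measures this is twice the supremum of \<open>\<bar>\<mu> A - \<nu> A\<bar>\<close>.\<close>

definition TV_norm_diff :: "'b measure \<Rightarrow> 'b measure \<Rightarrow> real" where
  "TV_norm_diff \<mu> \<nu> =
    (SUP P \<in> {P. finite P \<and> P \<subseteq> sets \<mu> \<and> partition_on (space \<mu>) P}.
      \<Sum>A\<in>P. \<bar>measure \<mu> A - measure \<nu> A\<bar>)"

end

theory Submission
  imports Defs
begin

text \<open>Write \<open>a\<^sub>n\<close> for the density of the marginal corrected at step \<open>n\<close> with respect to its
  target. Then \<open>KL(\<pi>\<^sup>\<star> | \<pi>\<^sup>n)\<close> decreases by \<open>KL(\<pi>\<^sup>n\<^sup>+\<^sup>1 | \<pi>\<^sup>n) = \<integral> (a\<^sub>n - 1 - ln a\<^sub>n)\<close>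
  at step \<open>n\<close>, so these divergences are summable, and it suffices to show that their sum exhausts
  \<open>KL(\<pi>\<^sup>\<star> | \<pi>\<^sup>0)\<close>: the total variation then tends to 0 by the Hellinger bound.

  By lower semicontinuity of the entropy and minimality of \<open>\<pi>\<^sup>\<star>\<close>, this follows if, at the ends of
  infinitely many cycles, \<open>KL(\<pi>\<^sup>n | \<pi>\<^sup>0)\<close> exceeds the exhausted part by arbitrarily little.
  The excess is the integral of the accumulated log-potentials \<open>- \<Sum> ln a\<close> against the marginal
  errors \<open>a - 1\<close>. As \<open>a\<close> is bounded by (A6), \<open>- ln a = (a - 1 - ln a) + (1 - a)\<close> splits
  the log-potentials into a part converging in \<open>L\<^sup>1\<close>, which contributes nothing in the limit, and
  partial sums \<open>G\<close> of \<open>1 - a\<close>. The latter contribute \<open>- \<integral> G dG = (\<bar>G\<bar>\<^sup>2 - \<bar>G + dG\<bar>\<^sup>2 + \<bar>dG\<bar>\<^sup>2) / 2\<close> with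
  \<open>\<Sum> \<bar>dG\<bar>\<^sup>2 < \<infinity>\<close>, which cannot stay above a positive constant.\<close>

section \<open>Entropy and its lower semicontinuity\<close>

text \<open>The obstacle is that the marginal errors are only square-summable, while the potentials
  paired with them need not stay bounded. At the end of a cycle the last marginal is exact, and any
  other marginal \<open>j\<close> is off by precisely what the steps \<open>k \<le> j\<close> of the
  next cycle will change. Only the step \<open>k = j\<close> pairs \<open>G\<close> with its own
  increment; a step \<open>k < j\<close> pairs the potential of one coordinate with the error of
  another, and nothing telescopes. These terms cost a factor \<open>1 + const * E m\<close> with
  \<open>E\<close> summable, so a discrete Gronwall argument still excludes a permanent drift. It
  yields infinitely many good cycles only, which is enough because the divergence from
  \<open>\<pi>\<^sup>\<star>\<close> is monotone. (A6) enters a second time: undoing a step costs at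
  most a factor \<open>c\<close>, so within a cycle norms under the iterates are bounded by norms
  under the targets. Step 0 is special, since the formula for \<open>\<pi> 1\<close> may involve
  \<open>\<psi> 0\<close> at several coordinates; that this step corrects a single coordinate is
  extracted from the minimality of the projection.\<close>

lemma sqrt_minus_one_sq_le:
  fixes w :: real
  assumes "0 < w"
  shows "(sqrt w - 1)\<^sup>2 \<le> w - 1 - ln w"
proof -
  have "ln (sqrt w) \<le> sqrt w - 1"
    using assms by (intro ln_le_minus_one) simp
  moreover have "ln w = 2 * ln (sqrt w)"
    using assms by (simp add: ln_sqrt)
  moreover have "(sqrt w - 1)\<^sup>2 = w + 1 - 2 * sqrt w"
    using assms by (simp add: power2_diff)
  ultimately show ?thesis by linarith
qed

text \<open>The factor \<open>sqrt w + 1\<close> of \<open>w - 1\<close> is at most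
  \<open>sqrt c + 1\<close>. This is how an upper bound on \<open>a\<close> turns entropy decrements
  into squared L2 errors; for unbounded \<open>w\<close> the right side grows only linearly.\<close>

lemma minus_one_sq_le:
  fixes w c :: real
  assumes "0 < w" "w \<le> c"
  shows "(w - 1)\<^sup>2 \<le> (sqrt c + 1)\<^sup>2 * (w - 1 - ln w)"
proof -
  have "w - 1 = (sqrt w + 1) * (sqrt w - 1)"
    using assms by (simp add: algebra_simps)
  then have "(w - 1)\<^sup>2 = (sqrt w + 1)\<^sup>2 * (sqrt w - 1)\<^sup>2"
    by (simp add: power_mult_distrib)
  also have "\<dots> \<le> (sqrt c + 1)\<^sup>2 * (w - 1 - ln w)"
    using assms by (intro mult_mono sqrt_minus_one_sq_le power_mono) auto
  finally show ?thesis .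
qed

text \<open>This is \<open>ln r \<le> r - 1\<close> at \<open>r = sqrt (s / a)\<close>, multiplied
  by \<open>a\<close>. Integrated over densities it bounds the squared Hellinger distance by the
  relative entropy.\<close>

lemma sqrt_diff_sq_le_mult_ln:
  fixes a s :: real
  assumes "0 \<le> a" "0 < s"
  shows "(sqrt a - sqrt s)\<^sup>2 \<le> a * ln a - a * ln s - a + s"
proof (cases "a = 0")
  case False
  then have a: "0 < a" using assms by simp
  have "ln (sqrt (s / a)) \<le> sqrt (s / a) - 1"
    using a assms by (intro ln_le_minus_one) simp
  moreover have "ln (sqrt (s / a)) = (ln s - ln a) / 2"
    using a assms by (simp add: ln_sqrt ln_div)
  ultimately have "a * ((ln s - ln a) / 2) \<le> a * (sqrt (s / a) - 1)"
    using a by (intro mult_left_mono) auto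
  then have "a * ln s - a * ln a \<le> 2 * (a * sqrt (s / a)) - 2 * a"
    by (simp add: right_diff_distrib divide_le_eq)
  moreover have "a * sqrt (s / a) = sqrt a * sqrt s"
    using a assms by (simp add: real_sqrt_divide real_div_sqrt field_simps)
  ultimately have "a * ln s - a * ln a \<le> 2 * (sqrt a * sqrt s) - 2 * a"
    by linarith
  moreover have "(sqrt a - sqrt s)\<^sup>2 = a + s - 2 * (sqrt a * sqrt s)"
    using assms by (simp add: power2_diff)
  ultimately show ?thesis by simp
qed (use assms in simp)

text \<open>Compare \<open>a\<close> and \<open>b\<close> separately with their midpoint; the linear
  terms cancel because \<open>a + b = 2 * s\<close>. This is uniform convexity of
  \<open>t * ln t\<close>, measured in the Hellinger distance.\<close>

lemma mult_ln_midpoint: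
  fixes a b :: real
  assumes "0 \<le> a" "0 \<le> b"
  defines "s \<equiv> (a + b) / 2"
  shows "(sqrt a - sqrt b)\<^sup>2 / 2 \<le> a * ln a + b * ln b - 2 * (s * ln s)"
proof (cases "s = 0")
  case True
  then have "a = 0" "b = 0" using assms by auto
  then show ?thesis by (simp add: s_def)
next
  case False
  then have s: "0 < s" using assms by auto
  have "(sqrt a - sqrt b)\<^sup>2 \<le> 2 * ((sqrt a - sqrt s)\<^sup>2 + (sqrt b - sqrt s)\<^sup>2)"
  proof -
    have "(x - y)\<^sup>2 \<le> 2 * ((x - z)\<^sup>2 + (y - z)\<^sup>2)" for x y z :: real
      using zero_le_power2[of "x + y - 2 * z"] by (simp add: power2_eq_square algebra_simps)
    then show ?thesis .
  qed
  also have "(sqrt a - sqrt s)\<^sup>2 + (sqrt b - sqrt s)\<^sup>2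
      \<le> (a * ln a - a * ln s - a + s) + (b * ln b - b * ln s - b + s)"
    using assms s by (intro add_mono sqrt_diff_sq_le_mult_ln) auto
  also have "\<dots> = a * ln a + b * ln b - (a + b) * ln s - (a + b) + 2 * s"
    by (simp add: algebra_simps)
  also have "\<dots> = a * ln a + b * ln b - 2 * (s * ln s)"
  proof -
    have ab: "a + b = 2 * s" by (simp add: s_def)
    show ?thesis by (simp add: ab)
  qed
  finally show ?thesis by simp
qed

lemma mult_ln_ge: "0 \<le> t \<Longrightarrow> t - 1 \<le> t * ln t" for t :: real
  using order_trans[OF zero_le_power2[of "sqrt t - sqrt 1"] sqrt_diff_sq_le_mult_ln[of t 1]] by simp

text \<open>Cauchy-Schwarz for the product \<open>(sqrt f - sqrt g) * (sqrt f + sqrt g)\<close>,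
  carried out pointwise by AM-GM with a free weight \<open>t\<close>. The optimum is
  \<open>t = sqrt D / 2\<close>; for \<open>D = 0\<close> the weight tends to zero.\<close>

lemma L1_dist_le_hellinger:
  fixes f g :: "'b \<Rightarrow> real"
  assumes [measurable]: "integrable M f" "integrable M g"
    and f: "\<And>x. 0 \<le> f x" "integral\<^sup>L M f \<le> 1"
    and g: "\<And>x. 0 \<le> g x" "integral\<^sup>L M g \<le> 1"
    and D: "integrable M (\<lambda>x. (sqrt (f x) - sqrt (g x))\<^sup>2)"
      "(\<integral>x. (sqrt (f x) - sqrt (g x))\<^sup>2 \<partial>M) \<le> D"
  shows "(\<integral>x. \<bar>f x - g x\<bar> \<partial>M) \<le> 2 * sqrt D"
proof -
  have bound: "(\<integral>x. \<bar>f x - g x\<bar> \<partial>M) \<le> D / (2 * t) + 2 * t" if t: "0 < t" for t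
  proof -
    have pw: "\<bar>f x - g x\<bar> \<le> (sqrt (f x) - sqrt (g x))\<^sup>2 / (2 * t) + t * (f x + g x)" for x
    proof -
      define a where "a = \<bar>sqrt (f x) - sqrt (g x)\<bar>"
      define b where "b = sqrt (f x) + sqrt (g x)"
      have "f x - g x = (sqrt (f x) - sqrt (g x)) * b"
        using f(1)[of x] g(1)[of x] by (simp add: b_def algebra_simps)
      then have "\<bar>f x - g x\<bar> = a * b"
        using f(1)[of x] g(1)[of x] by (simp add: a_def b_def abs_mult)
      also have "0 \<le> (a - t * b)\<^sup>2 / (2 * t)"
        using t by simp
      then have "a * b \<le> a\<^sup>2 / (2 * t) + t * (b\<^sup>2 / 2)"
        using t by (simp add: power2_eq_square field_simps)
      also have "b\<^sup>2 / 2 \<le> f x + g x"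
        using sum_squares_bound[of "sqrt (f x)" "sqrt (g x)"] f(1)[of x] g(1)[of x]
        by (simp add: b_def power2_sum)
      finally show ?thesis
        using t by (simp add: a_def)
    qed
    have "(\<integral>x. \<bar>f x - g x\<bar> \<partial>M) \<le>
        (\<integral>x. (sqrt (f x) - sqrt (g x))\<^sup>2 / (2 * t) + t * (f x + g x) \<partial>M)"
      using assms by (intro integral_mono pw) auto
    also have "\<dots> = (\<integral>x. (sqrt (f x) - sqrt (g x))\<^sup>2 \<partial>M) / (2 * t) +
        t * (integral\<^sup>L M f + integral\<^sup>L M g)"
      using assms by (subst Bochner_Integration.integral_add) auto
    also have "\<dots> \<le> D / (2 * t) + t * (1 + 1)"
      using assms t by (intro add_mono divide_right_mono mult_left_mono) auto
    finally show ?thesis by simp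
  qed
  have D0: "0 \<le> D"
    using D(2) by (rule order_trans[rotated]) simp
  show ?thesis
  proof (cases "D = 0")
    case True
    show ?thesis
    proof (rule field_le_epsilon)
      fix e :: real assume "0 < e"
      then show "(\<integral>x. \<bar>f x - g x\<bar> \<partial>M) \<le> 2 * sqrt D + e"
        using bound[of "e / 2"] True by simp
    qed
  next
    case False
    then have "0 < sqrt D" using D0 by simp
    moreover have "D / sqrt D = sqrt D" using D0 by (simp add: real_div_sqrt)
    ultimately show ?thesis
      using bound[of "sqrt D / 2"] by simp
  qed
qed

text \<open>Fatou's lemma, with bounds that converge in place of the integrals themselves.\<close>

lemma integral_le_of_AE_tendsto:
  fixes g :: "nat \<Rightarrow> 'b \<Rightarrow> real"
  assumes g: "\<And>n. integrable M (g n)" "\<And>n x. 0 \<le> g n x" "\<And>n. integral\<^sup>L M (g n) \<le> c n"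
    and c: "c \<longlonglongrightarrow> l"
    and h: "h \<in> borel_measurable M" "\<And>x. 0 \<le> h x" "AE x in M. (\<lambda>n. g n x) \<longlonglongrightarrow> h x"
  shows "integrable M h" "integral\<^sup>L M h \<le> l"
proof -
  note [measurable] = h(1) and [measurable] = g(1)[THEN borel_measurable_integrable]
  have c0: "0 \<le> c n" for n
    using g(2) by (intro order_trans[OF _ g(3)] Bochner_Integration.integral_nonneg)
  then have l0: "0 \<le> l"
    using c by (meson LIMSEQ_le_const)
  have "(\<integral>\<^sup>+x. ennreal (h x) \<partial>M) = (\<integral>\<^sup>+x. liminf (\<lambda>n. ennreal (g n x)) \<partial>M)"
  proof (rule nn_integral_cong_AE)
    show "AE x in M. ennreal (h x) = liminf (\<lambda>n. ennreal (g n x))"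
      using h(3)
    proof eventually_elim
      case (elim x)
      then have "(\<lambda>n. ennreal (g n x)) \<longlonglongrightarrow> ennreal (h x)"
        by (rule tendsto_ennrealI)
      then show ?case
        by (simp add: lim_imp_Liminf)
    qed
  qed
  also have "\<dots> \<le> liminf (\<lambda>n. \<integral>\<^sup>+x. ennreal (g n x) \<partial>M)"
    by (rule nn_integral_liminf) measurable
  also have "\<dots> = liminf (\<lambda>n. ennreal (integral\<^sup>L M (g n)))"
    using g by (simp add: nn_integral_eq_integral)
  also have "\<dots> \<le> liminf (\<lambda>n. ennreal (c n))"
    using g by (intro Liminf_mono always_eventually allI ennreal_leI)
  also have "\<dots> = ennreal l"
    by (intro lim_imp_Liminf tendsto_ennrealI c) simp
  finally have le: "(\<integral>\<^sup>+x. ennreal (h x) \<partial>M) \<le> ennreal l" .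
  then show "integrable M h"
    using h by (intro integrableI_nonneg) (auto simp: top_unique less_top[symmetric])
  then have "ennreal (integral\<^sup>L M h) \<le> ennreal l"
    using le h by (simp add: nn_integral_eq_integral)
  then show "integral\<^sup>L M h \<le> l"
    using l0 by simp
qed

text \<open>Only \<open>t = 0\<close> needs an argument: with \<open>s = sqrt u\<close>, one has
  \<open>u * ln u = 2 * s * (s * ln s)\<close>, and \<open>s * ln s\<close> stays between -1 and
  0.\<close>

lemma tendsto_mult_ln:
  fixes u :: "nat \<Rightarrow> real"
  assumes u: "u \<longlonglongrightarrow> t" "\<And>n. 0 \<le> u n"
  shows "(\<lambda>n. u n * ln (u n)) \<longlonglongrightarrow> t * ln t"
proof (cases "t = 0")
  case False
  then show ?thesis
    by (intro tendsto_intros u)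
next
  case True
  have "eventually (\<lambda>n. norm (u n * ln (u n)) \<le> 2 * sqrt (u n)) sequentially"
  proof -
    have "eventually (\<lambda>n. u n < 1) sequentially"
      using order_tendstoD(2)[OF u(1), of 1] True by simp
    then show ?thesis
    proof eventually_elim
      case (elim n)
      define s where "s = sqrt (u n)"
      have s: "0 \<le> s" "s \<le> 1" "u n = s * s"
        using u(2)[of n] elim by (auto simp: s_def)
      have "s * ln s \<le> 0"
        using s by (cases "s = 0") (auto intro: mult_nonneg_nonpos)
      moreover have "s - 1 \<le> s * ln s"
        using s by (intro mult_ln_ge)
      ultimately have "\<bar>s * ln s\<bar> \<le> 1" using s by simp
      then have "2 * s * \<bar>s * ln s\<bar> \<le> 2 * s * 1"
        using s by (intro mult_left_mono) auto
      moreover have "u n * ln (u n) = 2 * s * (s * ln s)"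
        using s by (cases "s = 0") (auto simp: ln_mult)
      moreover have "\<bar>2 * s * (s * ln s)\<bar> = 2 * s * \<bar>s * ln s\<bar>"
        using s by (simp only: abs_mult[of "2 * s"])
      ultimately show ?case
        by (simp add: s_def[symmetric])
    qed
  qed
  moreover have "(\<lambda>n. 2 * sqrt (u n)) \<longlonglongrightarrow> 2 * sqrt 0"
    using u(1) True by (intro tendsto_intros) simp
  ultimately have "(\<lambda>n. u n * ln (u n)) \<longlonglongrightarrow> 0"
    unfolding real_sqrt_zero mult_zero_right by (rule Lim_null_comparison)
  then show ?thesis using True by simp
qed

text \<open>The densities with nearly admissible entropy and nearly correct constraints form a decreasing
  sequence of convex sets, and near-minimisers of the entropy in them are Cauchy in \<open>L\<^sup>1\<close>, by
  uniform midpoint convexity of \<open>t ln t\<close>. This replaces weak compactness of entropy balls.\<close>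

lemma (in prob_space) exists_entropy_limit:
  fixes B :: "'i \<Rightarrow> 'a set" and m :: "'i \<Rightarrow> real" and b :: real
  assumes B: "\<And>i. i \<in> J \<Longrightarrow> B i \<in> sets M"
    and approx: "\<And>\<epsilon>. 0 < \<epsilon> \<Longrightarrow> \<exists>f :: 'a \<Rightarrow> real. f \<in> borel_measurable M \<and> (\<forall>x. 0 \<le> f x) \<and>
      integrable M f \<and> integral\<^sup>L M f = 1 \<and> integrable M (\<lambda>x. f x * ln (f x)) \<and>
      (\<integral>x. f x * ln (f x) \<partial>M) \<le> b + \<epsilon> \<and>
      (\<forall>i\<in>J. \<bar>(\<integral>x. f x * indicator (B i) x \<partial>M) - m i\<bar> \<le> \<epsilon>)"
  shows "\<exists>f :: 'a \<Rightarrow> real. f \<in> borel_measurable M \<and> (\<forall>x. 0 \<le> f x) \<and>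
      integrable M f \<and> integral\<^sup>L M f = 1 \<and> integrable M (\<lambda>x. f x * ln (f x)) \<and>
      (\<integral>x. f x * ln (f x) \<partial>M) \<le> b \<and>
      (\<forall>i\<in>J. (\<integral>x. f x * indicator (B i) x \<partial>M) = m i)"
proof -
  define ent where "ent f = (\<integral>x. f x * ln (f x) \<partial>M)" for f :: "'a \<Rightarrow> real"
  define C where "C \<epsilon> = {f :: 'a \<Rightarrow> real. f \<in> borel_measurable M \<and> (\<forall>x. 0 \<le> f x) \<and>
      integrable M f \<and> integral\<^sup>L M f = 1 \<and> integrable M (\<lambda>x. f x * ln (f x)) \<and>
      ent f \<le> b + \<epsilon> \<and> (\<forall>i\<in>J. \<bar>(\<integral>x. f x * indicator (B i) x \<partial>M) - m i\<bar> \<le> \<epsilon>)}" for \<epsilon>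
  define \<delta> where "\<delta> n = inverse (real (Suc n))" for n
  have \<delta>: "0 < \<delta> n" "m \<le> n \<Longrightarrow> \<delta> n \<le> \<delta> m" for m n
    by (auto simp: \<delta>_def divide_simps)
  have \<delta>0: "\<delta> \<longlonglongrightarrow> 0"
    unfolding \<delta>_def by (rule LIMSEQ_inverse_real_of_nat)
  have C_D: "f \<in> borel_measurable M" "\<And>x. 0 \<le> f x" "integrable M f" "integral\<^sup>L M f = 1"
      "integrable M (\<lambda>x. f x * ln (f x))" "ent f \<le> b + \<epsilon>"
      "\<And>i. i \<in> J \<Longrightarrow> \<bar>(\<integral>x. f x * indicator (B i) x \<partial>M) - m i\<bar> \<le> \<epsilon>"
    if "f \<in> C \<epsilon>" for f \<epsilon>
    using that unfolding C_def by blast+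
  have C_ne: "C \<epsilon> \<noteq> {}" if "0 < \<epsilon>" for \<epsilon>
    using approx[OF that] by (auto simp: C_def ent_def)
  have C_mono: "C \<epsilon> \<subseteq> C \<epsilon>'" if "\<epsilon> \<le> \<epsilon>'" for \<epsilon> \<epsilon>'
    using that by (force simp: C_def)
  have ent_nonneg: "0 \<le> ent f" if "f \<in> C \<epsilon>" for f \<epsilon>
  proof -
    have "0 = (\<integral>x. f x - 1 \<partial>M)"
      using C_D(3,4)[OF that] by (simp add: prob_space)
    also have "\<dots> \<le> ent f"
      unfolding ent_def using C_D(2,3,5)[OF that] by (intro integral_mono mult_ln_ge) simp_all
    finally show ?thesis .
  qed
  \<comment> \<open>Constraints and entropy are convex, so midpoints stay admissible, and the
    entropy drop at the midpoint pays for the Hellinger distance.\<close>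
  have mid: "(\<lambda>x. (f x + g x) / 2) \<in> C \<epsilon>"
       "integrable M (\<lambda>x. (sqrt (f x) - sqrt (g x))\<^sup>2)"
       "(\<integral>x. (sqrt (f x) - sqrt (g x))\<^sup>2 \<partial>M) \<le> 2 * (ent f + ent g - 2 * ent (\<lambda>x. (f x + g x) / 2))"
    if f: "f \<in> C \<epsilon>" and g: "g \<in> C \<epsilon>" for f g \<epsilon>
  proof -
    define s where "s = (\<lambda>x. (f x + g x) / 2)"
    have s_eq: "s x = (f x + g x) / 2" for x by (simp add: s_def)
    have [measurable]: "s \<in> borel_measurable M"
      unfolding s_def using C_D(1)[OF f] C_D(1)[OF g] by measurable
    have [measurable]: "f \<in> borel_measurable M" "g \<in> borel_measurable M"
      and nn: "\<And>x. 0 \<le> f x" "\<And>x. 0 \<le> g x"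
      and int: "integrable M f" "integrable M g"
        "integrable M (\<lambda>x. f x * ln (f x))" "integrable M (\<lambda>x. g x * ln (g x))"
      using C_D[OF f] C_D[OF g] by blast+
    have pw: "(sqrt (f x) - sqrt (g x))\<^sup>2 / 2 \<le> f x * ln (f x) + g x * ln (g x) - 2 * (s x * ln (s x))" for x
      unfolding s_eq by (rule mult_ln_midpoint) (use nn in auto)
    have ints: "integrable M (\<lambda>x. s x * ln (s x))"
    proof (rule Bochner_Integration.integrable_bound)
      show "integrable M (\<lambda>x. \<bar>f x * ln (f x)\<bar> + \<bar>g x * ln (g x)\<bar> + f x + g x + 1)"
        by (intro Bochner_Integration.integrable_add integrable_abs int integrable_const)
      show "AE x in M. norm (s x * ln (s x)) \<le> norm (\<bar>f x * ln (f x)\<bar> + \<bar>g x * ln (g x)\<bar> + f x + g x + 1)"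
      proof (rule AE_I2)
        fix x
        have abs_le: "\<bar>w\<bar> \<le> \<bar>\<bar>A\<bar> + \<bar>B\<bar> + u + v + 1\<bar>"
          if "2 * w \<le> A + B" "u / 2 + v / 2 - 1 \<le> w" "0 \<le> u" "0 \<le> v" for A B u v w :: real
          using that by linarith
        have "0 \<le> (sqrt (f x) - sqrt (g x))\<^sup>2 / 2" by simp
        then have "2 * (s x * ln (s x)) \<le> f x * ln (f x) + g x * ln (g x)"
          using pw[of x] by linarith
        moreover have "f x / 2 + g x / 2 - 1 \<le> s x * ln (s x)"
          unfolding s_eq[of x, unfolded add_divide_distrib, symmetric]
          by (rule mult_ln_ge) (simp add: s_eq nn)
        ultimately show "norm (s x * ln (s x)) \<le> norm (\<bar>f x * ln (f x)\<bar> + \<bar>g x * ln (g x)\<bar> + f x + g x + 1)"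
          unfolding real_norm_def using nn by (intro abs_le) assumption+
      qed
    qed measurable
    show sq: "integrable M (\<lambda>x. (sqrt (f x) - sqrt (g x))\<^sup>2)"
    proof (rule Bochner_Integration.integrable_bound)
      show "integrable M (\<lambda>x. 2 * (f x + g x))"
        by (intro integrable_mult_right Bochner_Integration.integrable_add int)
      show "AE x in M. norm ((sqrt (f x) - sqrt (g x))\<^sup>2) \<le> norm (2 * (f x + g x))"
      proof (rule AE_I2)
        fix x
        have "(sqrt (f x) - sqrt (g x))\<^sup>2 = 2 * (f x + g x) - (sqrt (f x) + sqrt (g x))\<^sup>2"
          using nn[of x] by (simp add: power2_diff power2_sum)
        also have "\<dots> \<le> 2 * (f x + g x)" by simp
        finally have "(sqrt (f x) - sqrt (g x))\<^sup>2 \<le> 2 * (f x + g x)" .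
        then show "norm ((sqrt (f x) - sqrt (g x))\<^sup>2) \<le> norm (2 * (f x + g x))"
          using nn[of x] by simp
      qed
    qed measurable
    have "(\<integral>x. (sqrt (f x) - sqrt (g x))\<^sup>2 / 2 \<partial>M) \<le>
        (\<integral>x. f x * ln (f x) + g x * ln (g x) - 2 * (s x * ln (s x)) \<partial>M)"
      using sq
      by (intro integral_mono pw integrable_divide Bochner_Integration.integrable_diff
          Bochner_Integration.integrable_add integrable_mult_right int ints)
    also have "\<dots> = ent f + ent g - 2 * ent s"
      unfolding ent_def
      by (simp only: integral_mult_right_zero Bochner_Integration.integral_add[OF int(3,4)]
          Bochner_Integration.integral_diff[OF Bochner_Integration.integrable_add[OF int(3,4)]
            integrable_mult_right[OF ints]])
    finally have hell: "(\<integral>x. (sqrt (f x) - sqrt (g x))\<^sup>2 \<partial>M) \<le> 2 * (ent f + ent g - 2 * ent s)"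
      by simp
    then show "(\<integral>x. (sqrt (f x) - sqrt (g x))\<^sup>2 \<partial>M) \<le> 2 * (ent f + ent g - 2 * ent (\<lambda>x. (f x + g x) / 2))"
      by (simp add: s_def)
    have "0 \<le> 2 * (ent f + ent g - 2 * ent s)"
      by (rule order_trans[OF _ hell]) simp
    then have "2 * ent s \<le> ent f + ent g" by simp
    then have ent_s: "ent s \<le> b + \<epsilon>" using C_D(6)[OF f] C_D(6)[OF g] by linarith
    have "\<bar>(\<integral>x. s x * indicator (B i) x \<partial>M) - m i\<bar> \<le> \<epsilon>" if i: "i \<in> J" for i
    proof -
      have "integrable M (\<lambda>x. f x * indicator (B i) x)" "integrable M (\<lambda>x. g x * indicator (B i) x)"
        by (rule integrable_real_mult_indicator[OF B[OF i] int(1)] integrable_real_mult_indicator[OF B[OF i] int(2)])+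
      then have "(\<integral>x. s x * indicator (B i) x \<partial>M) =
          ((\<integral>x. f x * indicator (B i) x \<partial>M) + (\<integral>x. g x * indicator (B i) x \<partial>M)) / 2"
        by (simp add: s_eq add_divide_distrib ring_distribs)
      moreover have "\<bar>(\<integral>x. f x * indicator (B i) x \<partial>M) - m i\<bar> \<le> \<epsilon>"
        "\<bar>(\<integral>x. g x * indicator (B i) x \<partial>M) - m i\<bar> \<le> \<epsilon>"
        using C_D(7)[OF f i] C_D(7)[OF g i] .
      moreover have "\<bar>w - t\<bar> \<le> \<epsilon>" if "w = (u + v) / 2" "\<bar>u - t\<bar> \<le> \<epsilon>" "\<bar>v - t\<bar> \<le> \<epsilon>"
        for t u v w :: real
        using that by (simp add: abs_le_iff field_simps)
      ultimately show ?thesis by blast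
    qed
    moreover have "integrable M s" "integral\<^sup>L M s = 1" "0 \<le> s x" for x
      unfolding s_def using C_D(4)[OF f] C_D(4)[OF g] int nn by simp_all
    ultimately show "(\<lambda>x. (f x + g x) / 2) \<in> C \<epsilon>"
      unfolding s_def[symmetric] using ints ent_s by (simp add: C_def)
  qed
  \<comment> \<open>The infima increase as the admissible sets shrink and are bounded, hence
    converge. This is what forces the near-minimisers together.\<close>
  define v where "v n = Inf (ent ` C (\<delta> n))" for n
  have bdd: "bdd_below (ent ` C \<epsilon>)" for \<epsilon>
    using ent_nonneg by (auto intro!: bdd_belowI)
  have v_le: "v n \<le> ent f" if "f \<in> C (\<delta> n)" for n f
    unfolding v_def by (rule cInf_lower[OF imageI[OF that] bdd])
  have "incseq v"
    unfolding v_def incseq_def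
    by (intro allI impI cInf_superset_mono image_mono bdd C_mono \<delta>(2)) (simp_all add: C_ne \<delta>(1))
  have v_bd: "v n \<le> b + 1" for n
  proof -
    obtain f where f: "f \<in> C (\<delta> n)" using C_ne[OF \<delta>(1)] by blast
    then have "ent f \<le> b + \<delta> n" by (rule C_D)
    moreover have "\<delta> n \<le> 1" by (simp add: \<delta>_def divide_simps)
    ultimately show ?thesis using v_le[OF f] by linarith
  qed
  obtain vl where vl: "v \<longlonglongrightarrow> vl" "\<forall>n. v n \<le> vl"
    using incseq_convergent[OF \<open>incseq v\<close>, of "b + 1"] v_bd by blast
  have "\<exists>f\<in>C (\<delta> n). ent f < v n + \<delta> n" for n
    using cInf_lessD[of "ent ` C (\<delta> n)" "v n + \<delta> n"] C_ne[OF \<delta>(1)] \<delta>(1)[of n]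
    unfolding v_def by (simp add: image_iff)
  then obtain q where "\<forall>n. q n \<in> C (\<delta> n) \<and> ent (q n) < v n + \<delta> n"
    using choice[of "\<lambda>n f. f \<in> C (\<delta> n) \<and> ent f < v n + \<delta> n"] by blast
  then have q: "\<And>n. q n \<in> C (\<delta> n)" "\<And>n. ent (q n) < v n + \<delta> n"
    by blast+
  have [measurable]: "q n \<in> borel_measurable M" and q_nn: "\<And>x. 0 \<le> q n x"
    and q_int: "integrable M (q n)" "integral\<^sup>L M (q n) = 1" "integrable M (\<lambda>x. q n x * ln (q n x))"
    and q_ent: "ent (q n) \<le> b + \<delta> n"
    for n by (rule C_D[OF q(1)])+
  \<comment> \<open>Both functions have entropy below \<open>vl + \<delta> N\<close>, whereas their
    midpoint lies in \<open>C (\<delta> N)\<close> and has entropy at least \<open>v N\<close>;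
    \<open>mid\<close> then gives the constant 4.\<close>
  have gap: "(\<integral>x. \<bar>q i x - q j x\<bar> \<partial>M) \<le> 2 * sqrt (4 * (vl - v N + \<delta> N))"
    if "N \<le> i" "N \<le> j" for i j N
  proof (rule L1_dist_le_hellinger)
    have ij: "q i \<in> C (\<delta> N)" "q j \<in> C (\<delta> N)"
      by (rule subsetD[OF C_mono[OF \<delta>(2)[OF that(1)]] q(1)],
          rule subsetD[OF C_mono[OF \<delta>(2)[OF that(2)]] q(1)])
    show "integrable M (\<lambda>x. (sqrt (q i x) - sqrt (q j x))\<^sup>2)"
      by (rule mid(2)[OF ij])
    have "x \<le> 4 * (L - V + D)"
      if "x \<le> 2 * (u + v - 2 * w)" "u < v1 + d1" "v < v2 + d2" "v1 \<le> L" "v2 \<le> L" "d1 \<le> D" "d2 \<le> D" "V \<le> w"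
      for x u v w v1 v2 d1 d2 D L V :: real
      using that by (simp add: algebra_simps)
    from this[OF mid(3)[OF ij] q(2) q(2) spec[OF vl(2)] spec[OF vl(2)] \<delta>(2)[OF that(1)] \<delta>(2)[OF that(2)]
        v_le[OF mid(1)[OF ij]]]
    show "(\<integral>x. (sqrt (q i x) - sqrt (q j x))\<^sup>2 \<partial>M) \<le> 4 * (vl - v N + \<delta> N)" .
  qed (rule q_int q_nn eq_refl)+
  have "(\<lambda>N. 2 * sqrt (4 * (vl - v N + \<delta> N))) \<longlonglongrightarrow> 2 * sqrt (4 * (vl - vl + 0))"
    by (rule tendsto_mult[OF tendsto_const tendsto_real_sqrt[OF tendsto_mult[OF tendsto_const
        tendsto_add[OF tendsto_diff[OF tendsto_const vl(1)] \<delta>0]]]])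
  then have lim0: "(\<lambda>N. 2 * sqrt (4 * (vl - v N + \<delta> N))) \<longlonglongrightarrow> 0"
    by simp
  have cauchy: "\<exists>N. \<forall>i\<ge>N. \<forall>j\<ge>N. (\<integral>x. \<bar>q i x - q j x\<bar> \<partial>M) < e" if e: "0 < e" for e
  proof -
    obtain N where "2 * sqrt (4 * (vl - v N + \<delta> N)) < e"
      using order_tendstoD(2)[OF lim0 e] unfolding eventually_sequentially by blast
    then show ?thesis
      by (intro exI[of _ N] allI impI) (rule le_less_trans[OF gap])
  qed
  then have cauchy': "\<exists>N. \<forall>i\<ge>N. \<forall>j\<ge>N. (\<integral>x. norm (q i x - q j x) \<partial>M) < e" if "0 < e" for e
    unfolding real_norm_def using that .
  obtain r where r: "strict_mono r" "AE x in M. Cauchy (\<lambda>i. q (r i) x)"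
    by (rule cauchy_L1_AE_cauchy_subseq[of M q, OF q_int(1) cauchy'])
  \<comment> \<open>\<open>max 0\<close> keeps \<open>f\<close> nonnegative also on the null set
    where the subsequence may fail to converge.\<close>
  define f where "f x = max 0 (lim (\<lambda>i. q (r i) x))" for x
  have f_meas[measurable]: "f \<in> borel_measurable M"
    unfolding f_def
    by (intro borel_measurable_max borel_measurable_const borel_measurable_lim_metric
        borel_measurable_integrable q_int)
  have f_nn: "0 \<le> f x" for x by (simp add: f_def)
  have f_lim: "AE x in M. (\<lambda>i. q (r i) x) \<longlonglongrightarrow> f x"
    using r(2)
  proof eventually_elim
    case (elim x)
    then have *: "(\<lambda>i. q (r i) x) \<longlonglongrightarrow> lim (\<lambda>i. q (r i) x)"
      by (simp add: Cauchy_convergent_iff convergent_LIMSEQ_iff)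
    moreover have "0 \<le> lim (\<lambda>i. q (r i) x)"
      using * q_nn by (intro LIMSEQ_le_const[OF *]) auto
    ultimately show ?case by (simp add: f_def)
  qed
  have f_int: "integrable M f"
    by (rule integral_le_of_AE_tendsto(1)[of M "\<lambda>i. q (r i)" "\<lambda>_. 1" 1, OF q_int(1) q_nn _ _ _ f_nn f_lim])
      (simp_all add: q_int(2) f_meas)
  \<comment> \<open>Fatou in the second index, shifted by \<open>i\<close> so that
    \<open>gap\<close> applies with \<open>N = i\<close>.\<close>
  have L1: "(\<integral>x. \<bar>q (r i) x - f x\<bar> \<partial>M) \<le> 2 * sqrt (4 * (vl - v i + \<delta> i))" for i
  proof (rule integral_le_of_AE_tendsto(2)[of M "\<lambda>j x. \<bar>q (r i) x - q (r (j + i)) x\<bar>"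
        "\<lambda>_. 2 * sqrt (4 * (vl - v i + \<delta> i))"])
    show "(\<integral>x. \<bar>q (r i) x - q (r (j + i)) x\<bar> \<partial>M) \<le> 2 * sqrt (4 * (vl - v i + \<delta> i))" for j
      using seq_suble[OF r(1), of i] seq_suble[OF r(1), of "j + i"] by (intro gap) auto
    show "AE x in M. (\<lambda>j. \<bar>q (r i) x - q (r (j + i)) x\<bar>) \<longlonglongrightarrow> \<bar>q (r i) x - f x\<bar>"
      using f_lim by eventually_elim (intro tendsto_intros LIMSEQ_ignore_initial_segment)
  qed (rule integrable_abs Bochner_Integration.integrable_diff q_int abs_ge_zero tendsto_const
      borel_measurable_abs borel_measurable_diff borel_measurable_integrable f_meas)+
  have L1_lim: "(\<lambda>i. \<integral>x. \<bar>q (r i) x - f x\<bar> \<partial>M) \<longlonglongrightarrow> 0"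
  proof (rule Lim_null_comparison[OF always_eventually[OF allI] lim0])
    fix i
    have "0 \<le> (\<integral>x. \<bar>q (r i) x - f x\<bar> \<partial>M)"
      by (rule Bochner_Integration.integral_nonneg) (rule abs_ge_zero)
    then show "norm (\<integral>x. \<bar>q (r i) x - f x\<bar> \<partial>M) \<le> 2 * sqrt (4 * (vl - v i + \<delta> i))"
      unfolding real_norm_def by (subst abs_of_nonneg) (assumption, rule L1)
  qed
  have q_lim: "(\<lambda>i. \<integral>x. q (r i) x * indicator A x \<partial>M) \<longlonglongrightarrow> (\<integral>x. f x * indicator A x \<partial>M)"
    if A: "A \<in> sets M" for A
  proof -
    have ints: "integrable M (\<lambda>x. q (r i) x * indicator A x)" "integrable M (\<lambda>x. f x * indicator A x)" for i
      by (rule integrable_real_mult_indicator[OF A q_int(1)] integrable_real_mult_indicator[OF A f_int])+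
    have "norm ((\<integral>x. q (r i) x * indicator A x \<partial>M) - (\<integral>x. f x * indicator A x \<partial>M))
        \<le> (\<integral>x. \<bar>q (r i) x - f x\<bar> \<partial>M)" for i
    proof -
      have "norm ((\<integral>x. q (r i) x * indicator A x \<partial>M) - (\<integral>x. f x * indicator A x \<partial>M))
          = \<bar>\<integral>x. q (r i) x * indicator A x - f x * indicator A x \<partial>M\<bar>"
        by (simp only: Bochner_Integration.integral_diff[OF ints] real_norm_def)
      also have "\<dots> \<le> (\<integral>x. \<bar>q (r i) x * indicator A x - f x * indicator A x\<bar> \<partial>M)"
        by (rule integral_abs_bound)
      also have "\<dots> \<le> (\<integral>x. \<bar>q (r i) x - f x\<bar> \<partial>M)"
        by (intro integral_mono integrable_abs Bochner_Integration.integrable_diff ints q_int f_int)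
          (simp add: indicator_def)
      finally show ?thesis .
    qed
    then show ?thesis
      by (rule LIM_zero_cancel[OF Lim_null_comparison[OF always_eventually[OF allI] L1_lim]])
  qed
  have f1: "integral\<^sup>L M f = 1"
  proof -
    have sp: "(\<integral>x. g x * indicator (space M) x \<partial>M) = integral\<^sup>L M g" for g :: "'a \<Rightarrow> real"
      by (intro Bochner_Integration.integral_cong) auto
    have "(\<lambda>i. 1) \<longlonglongrightarrow> integral\<^sup>L M f"
      using q_lim[OF sets.top] unfolding sp q_int(2) .
    then show ?thesis
      by (simp add: tendsto_const_iff)
  qed
  have f_m: "(\<integral>x. f x * indicator (B i) x \<partial>M) = m i" if i: "i \<in> J" for i
  proof -
    have "norm ((\<integral>x. q (r n) x * indicator (B i) x \<partial>M) - m i) \<le> \<delta> n" for n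
    proof -
      have "q (r n) \<in> C (\<delta> n)"
        by (rule subsetD[OF C_mono[OF \<delta>(2)[OF seq_suble[OF r(1)]]] q(1)])
      then show ?thesis
        using C_D(7) i by simp
    qed
    then have "(\<lambda>n. \<integral>x. q (r n) x * indicator (B i) x \<partial>M) \<longlonglongrightarrow> m i"
      by (rule LIM_zero_cancel[OF Lim_null_comparison[OF always_eventually[OF allI] \<delta>0]])
    then show ?thesis
      using q_lim[OF B[OF i]] LIMSEQ_unique by blast
  qed
  \<comment> \<open>Adding \<open>1 - t\<close> makes \<open>t * ln t\<close> nonnegative, as Fatou
    requires, without changing the integral over a probability density.\<close>
  have ent_lim: "AE x in M. (\<lambda>i. q (r i) x * ln (q (r i) x) - q (r i) x + 1) \<longlonglongrightarrow> f x * ln (f x) - f x + 1"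
    using f_lim by eventually_elim (intro tendsto_intros tendsto_mult_ln q_nn)
  have ent_c: "(\<integral>x. q (r i) x * ln (q (r i) x) - q (r i) x + 1 \<partial>M) \<le> b + \<delta> i" for i
  proof -
    have "(\<integral>x. q (r i) x * ln (q (r i) x) - q (r i) x + 1 \<partial>M) = ent (q (r i))"
      unfolding ent_def using q_int(2)
      by (simp add: prob_space q_int(1,3))
    then show ?thesis
      using q_ent[of "r i"] \<delta>(2)[OF seq_suble[OF r(1)], of i] by simp
  qed
  have b_lim: "(\<lambda>i. b + \<delta> i) \<longlonglongrightarrow> b"
    using tendsto_add[OF tendsto_const \<delta>0] by simp
  have nn: "0 \<le> t * ln t - t + 1" if "0 \<le> t" for t :: real
    using mult_ln_ge[OF that] by simp
  note F = integral_le_of_AE_tendsto[OF _ _ ent_c b_lim _ _ ent_lim]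
  have ent_int: "integrable M (\<lambda>x. f x * ln (f x) - f x + 1)"
    by (rule F(1)) (simp_all add: q_int q_nn f_nn nn f_meas)
  then have ent_int': "integrable M (\<lambda>x. f x * ln (f x))"
    using Bochner_Integration.integrable_add[OF ent_int
        Bochner_Integration.integrable_diff[OF f_int integrable_const[of 1]]] by simp
  have "(\<integral>x. f x * ln (f x) - f x + 1 \<partial>M) \<le> b"
    by (rule F(2)) (simp_all add: q_int q_nn f_nn nn f_meas)
  then have "(\<integral>x. f x * ln (f x) \<partial>M) \<le> b"
    using ent_int' f_int f1 by (simp add: prob_space)
  then show ?thesis
    using f_int f1 f_m ent_int' f_nn f_meas by (intro exI[of _ f]) simp
qed

text \<open>Discrete Gronwall: the integrating factor \<open>exp (- \<theta> * S m)\<close> absorbs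
  \<open>1 + \<theta> * E m\<close> and stays above a positive constant. Up to the summable
  \<open>E m\<close>, the weighted quantity \<open>R\<close> then loses at least
  \<open>\<kappa>\<close> in each step and would become negative.\<close>

lemma no_positive_drift:
  fixes Q E :: "nat \<Rightarrow> real"
  assumes Q: "\<And>m. 0 \<le> Q m" and E: "\<And>m. 0 \<le> E m" "summable E"
    and \<theta>: "0 \<le> \<theta>" and \<delta>: "0 < \<delta>"
    and step: "\<And>m. m0 \<le> m \<Longrightarrow> Q (Suc m) \<le> (1 + \<theta> * E m) * Q m + E m - \<delta>"
  shows False
proof -
  define S where "S m = (\<Sum>i<m. E i)" for m
  define R where "R m = Q m * exp (- \<theta> * S m)" for m
  define \<kappa> where "\<kappa> = \<delta> * exp (- \<theta> * suminf E)"
  have S: "0 \<le> S m" "S m \<le> suminf E" for m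
    unfolding S_def using E by (auto intro: sum_nonneg sum_le_suminf)
  have \<kappa>: "0 < \<kappa>" using \<delta> by (simp add: \<kappa>_def)
  have R: "R (Suc m) \<le> R m + E m - \<kappa>" if "m0 \<le> m" for m
  proof -
    let ?x = "exp (- \<theta> * S (Suc m))"
    have "?x = exp (- (\<theta> * E m)) * exp (- \<theta> * S m)"
      by (simp add: S_def exp_add[symmetric] algebra_simps)
    then have Qx: "Q m * ?x = exp (- (\<theta> * E m)) * R m"
      by (simp add: R_def)
    have "(1 + \<theta> * E m) * exp (- (\<theta> * E m)) \<le> exp (\<theta> * E m) * exp (- (\<theta> * E m))"
      by (intro mult_right_mono exp_ge_add_one_self) simp
    also have "\<dots> = 1" by (simp add: exp_add[symmetric])
    finally have 1: "(1 + \<theta> * E m) * exp (- (\<theta> * E m)) * R m \<le> 1 * R m"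
      using Q by (intro mult_right_mono) (simp_all add: R_def)
    have 2: "E m * ?x \<le> E m * 1"
      using E \<theta> S[of "Suc m"] by (intro mult_left_mono) auto
    have 3: "\<kappa> \<le> \<delta> * ?x"
      unfolding \<kappa>_def using \<delta> \<theta> S[of "Suc m"] by (intro mult_left_mono) (auto intro: mult_left_mono)
    have "R (Suc m) \<le> ((1 + \<theta> * E m) * Q m + E m - \<delta>) * ?x"
      unfolding R_def by (intro mult_right_mono step that) simp
    also have "\<dots> = (1 + \<theta> * E m) * (Q m * ?x) + E m * ?x - \<delta> * ?x"
      by (simp add: algebra_simps)
    also have "\<dots> = (1 + \<theta> * E m) * exp (- (\<theta> * E m)) * R m + E m * ?x - \<delta> * ?x"
      unfolding Qx by simp
    finally show ?thesis using 1 2 3 by simp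
  qed
  have le: "R (m0 + k) \<le> R m0 + (S (m0 + k) - S m0) - real k * \<kappa>" for k
  proof (induction k)
    case (Suc k)
    then show ?case using R[of "m0 + k"] by (simp add: S_def algebra_simps)
  qed simp
  obtain k where "R m0 + suminf E < real k * \<kappa>"
    using reals_Archimedean3[OF \<kappa>] by blast
  moreover have "0 \<le> R (m0 + k)" using Q by (simp add: R_def)
  ultimately show False
    using le[of k] S(2)[of "m0 + k"] S(1)[of m0] by linarith
qed

lemma abs_mult_le_weighted_squares:
  fixes x y t :: real
  assumes "0 < t"
  shows "\<bar>x * y\<bar> \<le> (t * x\<^sup>2 + y\<^sup>2 / t) / 2"
proof -
  have "0 \<le> (t * \<bar>x\<bar> - \<bar>y\<bar>)\<^sup>2 / t" using assms by simp
  also have "\<dots> = t * x\<^sup>2 + y\<^sup>2 / t - 2 * \<bar>x * y\<bar>"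
    using assms by (simp add: power2_eq_square abs_mult field_simps)
  finally show ?thesis by simp
qed

lemma (in finite_measure) integral_excess_tendsto:
  fixes f :: "'a \<Rightarrow> real"
  assumes "integrable M f"
  shows "(\<lambda>n. \<integral>x. max 0 (\<bar>f x\<bar> - real n) \<partial>M) \<longlonglongrightarrow> 0"
proof -
  have "(\<lambda>n. \<integral>x. max 0 (\<bar>f x\<bar> - real n) \<partial>M) \<longlonglongrightarrow> (\<integral>x. 0 \<partial>M)"
  proof (rule integral_dominated_convergence)
    show "integrable M (\<lambda>x. \<bar>f x\<bar>)" using assms by simp
    show "AE x in M. (\<lambda>n. max 0 (\<bar>f x\<bar> - real n)) \<longlonglongrightarrow> 0"
    proof (rule AE_I2, rule tendsto_eventually)
      fix x
      obtain N where "\<bar>f x\<bar> \<le> real N" using real_arch_simple by blast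
      then show "\<forall>\<^sub>F n in sequentially. max 0 (\<bar>f x\<bar> - real n) = 0"
        by (intro eventually_sequentiallyI[of N]) (simp add: max_def)
    qed
  qed (use assms in auto)
  then show ?thesis by simp
qed

lemma sum_lessThan_mult:
  fixes f :: "nat \<Rightarrow> 'a::comm_monoid_add"
  shows "(\<Sum>i<m * K. f i) = (\<Sum>i<m. \<Sum>j<K. f (i * K + j))"
proof (induction m)
  case (Suc m)
  have "(\<Sum>i<n + k. f i) = (\<Sum>i<n. f i) + (\<Sum>j<k. f (n + j))" for n k
    by (induction k) (simp_all add: add.assoc)
  from this[of "m * K" K] show ?case
    by (simp add: Suc add.commute)
qed simp

lemma measure_density_real:
  fixes f :: "'b \<Rightarrow> real"
  assumes f: "integrable M f" "\<And>x. 0 \<le> f x" and B: "B \<in> sets M"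
  shows "measure (density M f) B = (\<integral>x. f x * indicator B x \<partial>M)"
    and "emeasure (density M f) B = ennreal (\<integral>x. f x * indicator B x \<partial>M)"
proof -
  have int: "integrable M (\<lambda>x. f x * indicator B x)"
    by (rule integrable_real_mult_indicator[OF B f(1)])
  have "emeasure (density M f) B = (\<integral>\<^sup>+x. ennreal (f x * indicator B x) \<partial>M)"
    using f B by (subst emeasure_density) (auto intro!: nn_integral_cong simp: indicator_def)
  also have "\<dots> = ennreal (\<integral>x. f x * indicator B x \<partial>M)"
    using int f by (intro nn_integral_eq_integral) auto
  finally show "emeasure (density M f) B = ennreal (\<integral>x. f x * indicator B x \<partial>M)" .
  then show "measure (density M f) B = (\<integral>x. f x * indicator B x \<partial>M)"
    using f(2) by (simp add: measure_def integral_nonneg_AE)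
qed

lemma prob_space_density_real:
  fixes f :: "'b \<Rightarrow> real"
  assumes "integrable M f" "\<And>x. 0 \<le> f x" "integral\<^sup>L M f = 1"
  shows "prob_space (density M f)"
proof
  have "(\<integral>x. f x * indicator (space M) x \<partial>M) = integral\<^sup>L M f"
    by (rule Bochner_Integration.integral_cong) auto
  then show "emeasure (density M f) (space (density M f)) = 1"
    using measure_density_real(2)[OF assms(1,2) sets.top] assms(3) by simp
qed

section \<open>Cyclic fitting of marginals\<close>

text \<open>Here \<open>exp (d n)\<close> is the factor by which step \<open>n\<close> corrects marginal \<open>n mod K\<close>, and \<open>p\<close> is the
  density of the minimiser \<open>\<pi>\<^sup>\<star>\<close>. The bound \<open>exp_d_le\<close> excludes the step \<open>n = 0\<close>,
  about which the potentials say nothing.\<close>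

locale cyclic_fitting =
  fixes P :: "'b measure" and N :: "'a measure" and K :: nat and X :: "nat \<Rightarrow> 'b \<Rightarrow> 'a"
    and \<nu> :: "nat \<Rightarrow> 'a measure" and d :: "nat \<Rightarrow> 'a \<Rightarrow> real" and \<pi> :: "nat \<Rightarrow> 'b measure"
    and p :: "'b \<Rightarrow> real" and c :: real
  assumes K: "0 < K"
    and X: "\<And>k. k < K \<Longrightarrow> X k \<in> measurable P N"
    and prob_\<pi>: "\<And>n. prob_space (\<pi> n)"
    and \<pi>_0: "\<pi> 0 = P"
    and d[measurable]: "\<And>n. d n \<in> borel_measurable N"
    and \<pi>_Suc: "\<And>n. \<pi> (Suc n) = density (\<pi> n) (\<lambda>x. ennreal (exp (d n (X (n mod K) x))))"
    and marginal_\<pi>: "\<And>n. distr (\<pi> (Suc n)) N (X (n mod K)) = \<nu> (n mod K)"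
    and c: "1 \<le> c" and exp_d_le: "\<And>n y. 1 \<le> n \<Longrightarrow> n mod K + 1 < K \<Longrightarrow> exp (- d n y) \<le> c"
    and p[measurable]: "p \<in> borel_measurable P" and p_nonneg: "\<And>x. 0 \<le> p x"
    and p_int: "integrable P p" "integral\<^sup>L P p = 1" "integrable P (\<lambda>x. p x * ln (p x))"
    and marginal_p: "\<And>k. k < K \<Longrightarrow> distr (density P p) N (X k) = \<nu> k"
    and p_minimal: "\<And>q :: 'b \<Rightarrow> real. \<lbrakk>q \<in> borel_measurable P; \<And>x. 0 \<le> q x; integrable P q;
      integral\<^sup>L P q = 1; integrable P (\<lambda>x. q x * ln (q x));
      \<And>k. k < K \<Longrightarrow> distr (density P q) N (X k) = \<nu> k\<rbrakk>
      \<Longrightarrow> (\<integral>x. p x * ln (p x) \<partial>P) \<le> (\<integral>x. q x * ln (q x) \<partial>P)"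
begin

text \<open>\<open>a n\<close> is the density of marginal \<open>n mod K\<close> of \<open>\<pi> n\<close> with respect to the target marginal,
  \<open>e n\<close> is \<open>KL(\<pi> (n + 1) | \<pi> n)\<close>, and \<open>I\<close> is \<open>KL(\<pi>\<^sup>\<star> | P)\<close>.\<close>

definition a :: "nat \<Rightarrow> 'a \<Rightarrow> real" where "a n y = exp (- d n y)"
definition T :: "'b measure" where "T = density P p"
definition H :: "nat \<Rightarrow> 'b \<Rightarrow> real" where "H n x = (\<Sum>i<n. d i (X (i mod K) x))"
definition e :: "nat \<Rightarrow> real" where "e n = (\<integral>y. d n y \<partial>\<nu> (n mod K))"
definition I :: real where "I = (\<integral>x. p x * ln (p x) \<partial>P)"

section \<open>Transport of integrals between consecutive iterates\<close>

lemma mod_K[simp]: "n mod K < K"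
  using K by simp

lemma Xm[measurable]: "X (n mod K) \<in> measurable P N"
  by (simp add: X)

lemma sets_\<pi>[measurable_cong, simp]: "sets (\<pi> n) = sets P"
  by (induction n) (simp_all add: \<pi>_0 \<pi>_Suc)

lemma space_\<pi>[simp]: "space (\<pi> n) = space P"
  by (rule sets_eq_imp_space_eq) simp

lemma measurable_\<pi>[simp]: "measurable (\<pi> n) L = measurable P L"
  by (rule measurable_cong_sets) simp_all

lemma sets_T[measurable_cong, simp]: "sets T = sets P" and space_T[simp]: "space T = space P"
  by (simp_all add: T_def)

lemma measurable_T[simp]: "measurable T L = measurable P L"
  by (rule measurable_cong_sets) simp_all

lemma sets_\<nu>: "k < K \<Longrightarrow> sets (\<nu> k) = sets N"
  using marginal_p[of k, symmetric] by simp

lemma prob_P: "prob_space P"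
  using prob_\<pi>[of 0] by (simp add: \<pi>_0)

lemma prob_T: "prob_space T"
proof
  have "emeasure T (space T) = (\<integral>\<^sup>+x. ennreal (p x) \<partial>P)"
    unfolding T_def by (subst emeasure_density) (auto intro!: nn_integral_cong)
  also have "\<dots> = ennreal (integral\<^sup>L P p)"
    using p_int p_nonneg by (simp add: nn_integral_eq_integral)
  finally show "emeasure T (space T) = 1"
    by (simp add: p_int)
qed

lemma prob_\<nu>: "k < K \<Longrightarrow> prob_space (\<nu> k)"
  using marginal_p[of k, symmetric] prob_T X[of k]
  by (auto intro!: prob_space.prob_space_distr simp: T_def)

lemma measure_space_\<pi>[simp]: "measure (\<pi> n) (space P) = 1"
  using prob_space.prob_space[OF prob_\<pi>[of n]] by simp

lemma measure_space_T[simp]: "measure T (space P) = 1"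
  using prob_space.prob_space[OF prob_T] by simp

lemma a_measurable[measurable]: "a n \<in> borel_measurable N"
  unfolding a_def by measurable

lemma a_pos[simp]: "0 < a n y" "0 \<le> a n y"
  by (simp_all add: a_def)

lemma a_fun: "a n = (\<lambda>y. exp (- d n y))"
  by (simp add: fun_eq_iff a_def)

lemma a_le: "1 \<le> n \<Longrightarrow> n mod K + 1 < K \<Longrightarrow> a n y \<le> c"
  using exp_d_le by (simp add: a_def)

lemma borel_measurable_\<nu>[simp]: "k < K \<Longrightarrow> borel_measurable (\<nu> k) = borel_measurable N"
  by (rule measurable_cong_sets) (simp_all add: sets_\<nu>)

lemma integrable_\<nu>_iff:
  fixes w :: "'a \<Rightarrow> real"
  assumes "w \<in> borel_measurable N"
  shows "integrable (\<nu> (n mod K)) w \<longleftrightarrow> integrable (\<pi> (Suc n)) (\<lambda>x. w (X (n mod K) x))"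
  unfolding marginal_\<pi>[symmetric] using assms by (subst integrable_distr_eq) (simp_all add: X)

lemma integral_\<nu>:
  fixes w :: "'a \<Rightarrow> real"
  assumes "w \<in> borel_measurable N"
  shows "(\<integral>y. w y \<partial>\<nu> (n mod K)) = (\<integral>x. w (X (n mod K) x) \<partial>\<pi> (Suc n))"
  unfolding marginal_\<pi>[symmetric] using assms by (subst integral_distr) (simp_all add: X)

lemma integrable_\<nu>_iff_T:
  fixes w :: "'a \<Rightarrow> real"
  assumes "w \<in> borel_measurable N" "k < K"
  shows "integrable (\<nu> k) w \<longleftrightarrow> integrable T (\<lambda>x. w (X k x))"
  unfolding marginal_p[OF assms(2), symmetric] T_def using assms
  by (subst integrable_distr_eq) (simp_all add: X)

lemma integral_\<nu>_T:
  fixes w :: "'a \<Rightarrow> real"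
  assumes "w \<in> borel_measurable N" "k < K"
  shows "(\<integral>y. w y \<partial>\<nu> k) = (\<integral>x. w (X k x) \<partial>T)"
  unfolding marginal_p[OF assms(2), symmetric] T_def using assms
  by (subst integral_distr) (simp_all add: X)

text \<open>A step can be undone, because its factor never vanishes. Integrals against
  \<open>\<pi> n\<close> thereby move to \<open>\<pi> (Suc n)\<close>, under which the marginal
  \<open>n mod K\<close> is the target.\<close>

lemma \<pi>_rev: "\<pi> n = density (\<pi> (Suc n)) (\<lambda>x. ennreal (a n (X (n mod K) x)))"
proof -
  have "density (\<pi> (Suc n)) (\<lambda>x. ennreal (a n (X (n mod K) x))) =
      density (\<pi> n) (\<lambda>x. ennreal (exp (d n (X (n mod K) x))) * ennreal (a n (X (n mod K) x)))"
    unfolding \<pi>_Suc by (rule density_density_eq) simp_all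
  also have "\<dots> = density (\<pi> n) (\<lambda>_. 1)"
    by (rule density_cong) (simp_all add: a_def ennreal_mult[symmetric] exp_add[symmetric])
  finally show ?thesis by (simp add: density_1)
qed

lemma integrable_\<pi>_iff_Suc:
  fixes w :: "'b \<Rightarrow> real"
  assumes "w \<in> borel_measurable P"
  shows "integrable (\<pi> n) w \<longleftrightarrow> integrable (\<pi> (Suc n)) (\<lambda>x. a n (X (n mod K) x) * w x)"
  by (subst \<pi>_rev, subst integrable_density) (use assms in simp_all)

lemma integral_\<pi>_Suc:
  fixes w :: "'b \<Rightarrow> real"
  assumes "w \<in> borel_measurable P"
  shows "(\<integral>x. w x \<partial>\<pi> n) = (\<integral>x. a n (X (n mod K) x) * w x \<partial>\<pi> (Suc n))"
  by (subst \<pi>_rev, subst integral_density) (use assms in simp_all)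

lemma H_measurable[measurable]: "H n \<in> borel_measurable P"
  unfolding H_def by measurable

lemma \<pi>_density: "\<pi> n = density P (\<lambda>x. ennreal (exp (H n x)))"
proof (induction n)
  case 0
  show ?case by (simp add: \<pi>_0 H_def density_1)
next
  case (Suc n)
  have "\<pi> (Suc n) = density P (\<lambda>x. ennreal (exp (H n x)) * ennreal (exp (d n (X (n mod K) x))))"
    unfolding \<pi>_Suc by (subst Suc, rule density_density_eq) simp_all
  also have "\<dots> = density P (\<lambda>x. ennreal (exp (H (Suc n) x)))"
    by (rule density_cong) (simp_all add: H_def ennreal_mult[symmetric] exp_add)
  finally show ?case .
qed

lemma exp_H_int: "integrable P (\<lambda>x. exp (H n x))" "(\<integral>x. exp (H n x) \<partial>P) = 1"
proof -
  interpret prob_space "\<pi> n" by (rule prob_\<pi>)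
  have "integrable (density P (\<lambda>x. ennreal (exp (H n x)))) (\<lambda>_. 1 :: real)"
    unfolding \<pi>_density[symmetric] by simp
  then show "integrable P (\<lambda>x. exp (H n x))"
    by (subst (asm) integrable_density) simp_all
  have "(\<integral>x. 1 \<partial>density P (\<lambda>x. ennreal (exp (H n x)))) = (1 :: real)"
    unfolding \<pi>_density[symmetric] by simp
  then show "(\<integral>x. exp (H n x) \<partial>P) = 1"
    by (subst (asm) integral_density) simp_all
qed

lemma a_int: "integrable (\<nu> (n mod K)) (a n)" "(\<integral>y. a n y \<partial>\<nu> (n mod K)) = 1"
proof -
  interpret prob_space "\<pi> n" by (rule prob_\<pi>)
  show "integrable (\<nu> (n mod K)) (a n)"
    using integrable_\<pi>_iff_Suc[of "\<lambda>_. 1" n] by (simp add: integrable_\<nu>_iff)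
  show "(\<integral>y. a n y \<partial>\<nu> (n mod K)) = 1"
    using integral_\<pi>_Suc[of "\<lambda>_. 1" n] by (simp add: integral_\<nu>)
qed

section \<open>The entropy identity for the minimiser\<close>

lemma T_ratio_int: "integrable T (\<lambda>x. exp (H n x) / p x)" "(\<integral>x. exp (H n x) / p x \<partial>T) \<le> 1"
proof -
  \<comment> \<open>Where \<open>p\<close> vanishes the quotient is 0 by convention, so mass of
    \<open>\<pi> n\<close> outside the support of \<open>p\<close> is lost. Hence an inequality and
    not an equality in the integral bound.\<close>
  have bound: "norm (p x *\<^sub>R (exp (H n x) / p x)) \<le> norm (exp (H n x))" for x
    using p_nonneg[of x] by (cases "p x = 0") simp_all
  have int: "integrable P (\<lambda>x. p x *\<^sub>R (exp (H n x) / p x))"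
    by (rule Bochner_Integration.integrable_bound[OF exp_H_int(1)[of n] _ AE_I2[OF bound]]) measurable
  then show "integrable T (\<lambda>x. exp (H n x) / p x)"
    unfolding T_def by (subst integrable_density) (simp_all add: p_nonneg)
  have "(\<integral>x. exp (H n x) / p x \<partial>T) = (\<integral>x. p x *\<^sub>R (exp (H n x) / p x) \<partial>P)"
    unfolding T_def by (subst integral_density) (simp_all add: p_nonneg)
  also have "\<dots> \<le> (\<integral>x. exp (H n x) \<partial>P)"
    using bound by (intro integral_mono int exp_H_int) (auto simp: abs_le_iff)
  finally show "(\<integral>x. exp (H n x) / p x \<partial>T) \<le> 1"
    by (simp add: exp_H_int)
qed

lemma T_p_pos: "AE x in T. 0 < p x"
  unfolding T_def by (subst AE_density) (auto simp: ennreal_less_zero_iff)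

lemma ln_p_T: "integrable T (\<lambda>x. ln (p x))" "(\<integral>x. ln (p x) \<partial>T) = I"
  unfolding T_def I_def using p_int(3)
  by (simp_all add: integrable_density integral_density p_nonneg)

lemma log_ratio_ge: "AE x in T. 1 - exp (H n x) / p x \<le> ln (p x) - H n x"
  using T_p_pos
proof eventually_elim
  case (elim x)
  have "1 + (H n x - ln (p x)) \<le> exp (H n x - ln (p x))"
    by (rule exp_ge_add_one_self)
  also have "\<dots> = exp (H n x) / p x"
    using elim by (simp add: exp_diff)
  finally show ?case by simp
qed

text \<open>The step from \<open>n\<close> to \<open>n + 1\<close> dominates \<open>d n\<close> from above by the log-ratio at \<open>n\<close> and the
  likelihood ratio at \<open>n + 1\<close>, and from below by \<open>- a n\<close>.\<close>

lemma log_ratio_int: "integrable T (\<lambda>x. ln (p x) - H n x)"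
  and d_T_int: "i < n \<Longrightarrow> integrable T (\<lambda>x. d i (X (i mod K) x))"
proof (induction n arbitrary: i)
  case 0
  { case 1 show ?case using ln_p_T by (simp add: H_def) }
  { case 2 then show ?case by simp }
next
  case (Suc n)
  have d_int: "integrable T (\<lambda>x. d n (X (n mod K) x))"
  proof (rule Bochner_Integration.integrable_bound)
    show "integrable T (\<lambda>x. a n (X (n mod K) x) + \<bar>ln (p x) - H n x\<bar> + exp (H (Suc n) x) / p x)"
      using a_int(1)[of n]
      by (intro Bochner_Integration.integrable_add integrable_abs Suc.IH(1) T_ratio_int)
        (simp add: integrable_\<nu>_iff_T)
    show "AE x in T. norm (d n (X (n mod K) x)) \<le>
        norm (a n (X (n mod K) x) + \<bar>ln (p x) - H n x\<bar> + exp (H (Suc n) x) / p x)"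
      using log_ratio_ge[of "Suc n"] T_p_pos
    proof eventually_elim
      case (elim x)
      define u where "u = exp (H (Suc n) x) / p x"
      have u: "0 \<le> u" "1 - u \<le> ln (p x) - H (Suc n) x"
        using elim by (simp_all add: u_def)
      have "H (Suc n) x = H n x + d n (X (n mod K) x)"
        by (simp add: H_def)
      moreover have "1 - d n (X (n mod K) x) \<le> a n (X (n mod K) x)"
        using exp_ge_add_one_self[of "- d n (X (n mod K) x)"] by (simp add: a_def)
      moreover have "0 \<le> a n (X (n mod K) x)" by simp
      ultimately show ?case
        using u unfolding u_def[symmetric] real_norm_def by linarith
    qed
  qed simp
  { case 1
    have "integrable T (\<lambda>x. (ln (p x) - H n x) - d n (X (n mod K) x))"
      by (intro Bochner_Integration.integrable_diff d_int Suc.IH(1))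
    then show ?case by (simp add: H_def algebra_simps)
  }
  { case 2
    then show ?case using Suc.IH(2)[of i] d_int by (cases "i = n") auto
  }
qed

lemma d_int: "integrable (\<nu> (n mod K)) (d n)"
  using d_T_int[of n "Suc n"] by (simp add: integrable_\<nu>_iff_T)

text \<open>The left side is \<open>KL(\<pi>\<^sup>\<star> | \<pi> n)\<close>. Each correction
  depends on one coordinate, and \<open>T\<close> has the target marginals, so each
  \<open>d i\<close> has the same integral under \<open>T\<close> as under its target.\<close>

lemma log_ratio_integral: "(\<integral>x. ln (p x) - H n x \<partial>T) = I - (\<Sum>i<n. e i)"
proof -
  have "(\<integral>x. H n x \<partial>T) = (\<Sum>i<n. e i)"
    unfolding H_def using d_T_int
    by (subst Bochner_Integration.integral_sum) (auto simp: e_def integral_\<nu>_T)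
  moreover have "integrable T (H n)"
    unfolding H_def using d_T_int by (intro Bochner_Integration.integrable_sum) auto
  ultimately show ?thesis
    using ln_p_T by simp
qed

text \<open>Gibbs' inequality for \<open>\<pi>\<^sup>\<star>\<close> relative to \<open>\<pi> n\<close>.\<close>

lemma sum_e_le: "(\<Sum>i<n. e i) \<le> I"
proof -
  interpret T: prob_space T by (rule prob_T)
  have "0 \<le> (\<integral>x. 1 - exp (H n x) / p x \<partial>T)"
    using T_ratio_int[of n] by simp
  also have "\<dots> \<le> (\<integral>x. ln (p x) - H n x \<partial>T)"
    using T_ratio_int[of n] log_ratio_int[of n] log_ratio_ge[of n] by (intro integral_mono_AE) auto
  finally show ?thesis
    by (simp add: log_ratio_integral)
qed

text \<open>As \<open>a n\<close> has mean 1 under the target, adding \<open>a n - 1\<close> to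
  \<open>- ln (a n)\<close> keeps the integral and makes the integrand nonnegative.\<close>

lemma e_eq: "e n = (\<integral>y. a n y - 1 - ln (a n y) \<partial>\<nu> (n mod K))"
proof -
  interpret prob_space "\<nu> (n mod K)" by (rule prob_\<nu>) simp
  show ?thesis
    using a_int[of n] d_int[of n] by (simp add: e_def a_fun prob_space)
qed

lemma gap_int: "integrable (\<nu> (n mod K)) (\<lambda>y. a n y - 1 - ln (a n y))"
proof -
  interpret prob_space "\<nu> (n mod K)" by (rule prob_\<nu>) simp
  show ?thesis
    using a_int(1)[of n] d_int[of n] by (simp add: a_fun)
qed

lemma e_nonneg: "0 \<le> e n"
  unfolding e_eq by (intro integral_nonneg_AE AE_I2) (use ln_le_minus_one[of "a n _"] in simp)

lemma summable_e: "summable e" and suminf_e_le: "suminf e \<le> I"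
proof -
  show s: "summable e"
    by (rule summableI_nonneg_bounded[OF e_nonneg sum_e_le])
  show "suminf e \<le> I"
    by (rule suminf_le_const[OF s sum_e_le])
qed

text \<open>The linear terms of the pointwise Hellinger bound integrate to zero, leaving exactly
  \<open>KL(\<pi>\<^sup>\<star> | \<pi> n)\<close>.\<close>

lemma L1_le: "(\<integral>x. \<bar>exp (H n x) - p x\<bar> \<partial>P) \<le> 2 * sqrt (I - (\<Sum>i<n. e i))"
proof (rule L1_dist_le_hellinger)
  let ?w = "\<lambda>x. (sqrt (exp (H n x)) - sqrt (p x))\<^sup>2"
  show int: "integrable P ?w"
  proof (rule Bochner_Integration.integrable_bound)
    show "integrable P (\<lambda>x. 2 * (exp (H n x) + p x))"
      by (intro integrable_mult_right Bochner_Integration.integrable_add exp_H_int p_int)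
    show "AE x in P. norm (?w x) \<le> norm (2 * (exp (H n x) + p x))"
    proof (rule AE_I2)
      fix x
      have "?w x = 2 * (exp (H n x) + p x) - (sqrt (exp (H n x)) + sqrt (p x))\<^sup>2"
        using p_nonneg[of x] by (simp add: power2_diff power2_sum)
      also have "\<dots> \<le> 2 * (exp (H n x) + p x)" by simp
      finally show "norm (?w x) \<le> norm (2 * (exp (H n x) + p x))"
        using p_nonneg[of x] by simp
    qed
  qed simp
  have pH: "integrable P (\<lambda>x. p x * (ln (p x) - H n x))"
    "(\<integral>x. p x * (ln (p x) - H n x) \<partial>P) = I - (\<Sum>i<n. e i)"
    using log_ratio_int[of n] log_ratio_integral[of n] unfolding T_def
    by (simp_all add: integrable_density integral_density p_nonneg)
  have "integral\<^sup>L P ?w \<le> (\<integral>x. p x * (ln (p x) - H n x) - p x + exp (H n x) \<partial>P)"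
  proof (rule integral_mono[OF int])
    show "integrable P (\<lambda>x. p x * (ln (p x) - H n x) - p x + exp (H n x))"
      by (intro Bochner_Integration.integrable_add Bochner_Integration.integrable_diff pH p_int exp_H_int)
    show "?w x \<le> p x * (ln (p x) - H n x) - p x + exp (H n x)" for x
      using sqrt_diff_sq_le_mult_ln[OF p_nonneg[of x], of "exp (H n x)"]
      by (simp add: power2_commute right_diff_distrib)
  qed
  also have "\<dots> = I - (\<Sum>i<n. e i)"
    using pH p_int exp_H_int[of n] by simp
  finally show "integral\<^sup>L P ?w \<le> I - (\<Sum>i<n. e i)" .
qed (simp_all add: exp_H_int p_int p_nonneg)

subsection \<open>The excess entropy after a cycle\<close>

text \<open>A common bound for the product of the factors \<open>a\<close> met when moving forward
  within a cycle.\<close>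

definition C :: real where "C = c ^ K"
definition b :: "nat \<Rightarrow> real" where "b n = (\<integral>y. (a n y - 1)\<^sup>2 \<partial>\<nu> (n mod K))"
text \<open>By \<open>step_diff\<close> below, this is the integral of \<open>f (X j)\<close> before
  step \<open>k\<close> of cycle \<open>m\<close> minus the integral after it. It is written under
  the later measure because marginal \<open>k\<close> is exact there.\<close>

definition \<Delta> :: "nat \<Rightarrow> nat \<Rightarrow> nat \<Rightarrow> ('a \<Rightarrow> real) \<Rightarrow> real" where
  "\<Delta> m j k f = (\<integral>x. f (X j x) * (a (m * K + k) (X k x) - 1) \<partial>\<pi> (Suc (m * K + k)))"

lemma C_ge: "1 \<le> C" "i \<le> K \<Longrightarrow> c ^ i \<le> C"
  unfolding C_def using c by (auto intro: power_increasing)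

lemma cycle_mod: "k < K \<Longrightarrow> (m * K + k) mod K = k"
  by simp

lemma one_le_cycle: "1 \<le> m \<Longrightarrow> 1 \<le> m * K + k"
  using K by (cases m) (auto simp: Suc_le_eq)

section \<open>Comparison of the measures within one cycle\<close>

lemma nn_integral_le_Suc:
  assumes [measurable]: "w \<in> borel_measurable P" and n: "1 \<le> n" "n mod K + 1 < K"
  shows "(\<integral>\<^sup>+x. w x \<partial>\<pi> n) \<le> ennreal c * (\<integral>\<^sup>+x. w x \<partial>\<pi> (Suc n))"
proof -
  have "(\<integral>\<^sup>+x. w x \<partial>\<pi> n) = (\<integral>\<^sup>+x. ennreal (a n (X (n mod K) x)) * w x \<partial>\<pi> (Suc n))"
    by (subst \<pi>_rev, subst nn_integral_density) simp_all
  also have "\<dots> \<le> (\<integral>\<^sup>+x. ennreal c * w x \<partial>\<pi> (Suc n))"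
    using a_le[OF n] by (intro nn_integral_mono mult_right_mono ennreal_leI) auto
  finally show ?thesis by (simp add: nn_integral_cmult)
qed

text \<open>The steps crossed are \<open>k, ..., k + i - 1\<close>; the condition
  \<open>k + i < K\<close> keeps the last step of the cycle, which has no bound, out of this
  range.\<close>

lemma nn_integral_le_cycle:
  assumes [measurable]: "w \<in> borel_measurable P" and "1 \<le> m"
  shows "k + i < K \<Longrightarrow> (\<integral>\<^sup>+x. w x \<partial>\<pi> (m * K + k)) \<le> ennreal (c ^ i) * (\<integral>\<^sup>+x. w x \<partial>\<pi> (m * K + k + i))"
proof (induction i)
  case (Suc i)
  have "(\<integral>\<^sup>+x. w x \<partial>\<pi> (m * K + k)) \<le> ennreal (c ^ i) * (\<integral>\<^sup>+x. w x \<partial>\<pi> (m * K + k + i))"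
    using Suc by simp
  also have "\<dots> \<le> ennreal (c ^ i) * (ennreal c * (\<integral>\<^sup>+x. w x \<partial>\<pi> (Suc (m * K + k + i))))"
    using Suc.prems one_le_cycle[OF \<open>1 \<le> m\<close>, of "k + i"]
    by (intro mult_left_mono nn_integral_le_Suc) (simp_all add: add.assoc)
  also have "\<dots> = ennreal (c ^ Suc i) * (\<integral>\<^sup>+x. w x \<partial>\<pi> (m * K + k + Suc i))"
    using c by (simp add: ennreal_mult[symmetric] mult.assoc[symmetric] mult.commute)
  finally show ?case .
qed simp

text \<open>Move forward to the end of step \<open>j\<close>, where marginal \<open>j\<close> equals
  \<open>\<nu> j\<close>. Every step crossed costs a factor \<open>c\<close>, and none of them is
  the last one of the cycle.\<close>

lemma dominated_marginal:
  assumes f[measurable]: "f \<in> borel_measurable N" and fi: "integrable (\<nu> j) f"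
    and m: "1 \<le> m" and j: "j + 1 < K" and k: "k \<le> j + 1"
  shows "integrable (\<pi> (m * K + k)) (\<lambda>x. f (X j x))"
    and "(\<integral>x. \<bar>f (X j x)\<bar> \<partial>\<pi> (m * K + k)) \<le> C * (\<integral>y. \<bar>f y\<bar> \<partial>\<nu> j)"
proof -
  have Xj[measurable]: "X j \<in> measurable P N" using j by (intro X) simp
  have sj: "integrable (\<pi> (Suc (m * K + j))) (\<lambda>x. f (X j x))"
    using integrable_\<nu>_iff[OF f, of "m * K + j"] fi j by simp
  have "(\<integral>\<^sup>+x. ennreal \<bar>f (X j x)\<bar> \<partial>\<pi> (m * K + k))
      \<le> ennreal (c ^ (j + 1 - k)) * (\<integral>\<^sup>+x. ennreal \<bar>f (X j x)\<bar> \<partial>\<pi> (m * K + k + (j + 1 - k)))"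
    using m j k by (intro nn_integral_le_cycle) auto
  also have "m * K + k + (j + 1 - k) = Suc (m * K + j)" using k by simp
  also have "(\<integral>\<^sup>+x. ennreal \<bar>f (X j x)\<bar> \<partial>\<pi> (Suc (m * K + j))) = ennreal (\<integral>y. \<bar>f y\<bar> \<partial>\<nu> j)"
    using integral_\<nu>[of "\<lambda>y. \<bar>f y\<bar>" "m * K + j"] sj j by (subst nn_integral_eq_integral) simp_all
  also have "ennreal (c ^ (j + 1 - k)) * \<dots> \<le> ennreal C * ennreal (\<integral>y. \<bar>f y\<bar> \<partial>\<nu> j)"
    using j by (intro mult_right_mono ennreal_leI C_ge) auto
  also have "\<dots> = ennreal (C * (\<integral>y. \<bar>f y\<bar> \<partial>\<nu> j))"
    using C_ge(1) by (simp add: ennreal_mult)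
  finally have le: "(\<integral>\<^sup>+x. ennreal \<bar>f (X j x)\<bar> \<partial>\<pi> (m * K + k)) \<le> ennreal (C * (\<integral>y. \<bar>f y\<bar> \<partial>\<nu> j))" .
  then show int: "integrable (\<pi> (m * K + k)) (\<lambda>x. f (X j x))"
    unfolding integrable_iff_bounded by (auto intro: le_less_trans)
  have "ennreal (\<integral>x. \<bar>f (X j x)\<bar> \<partial>\<pi> (m * K + k)) \<le> ennreal (C * (\<integral>y. \<bar>f y\<bar> \<partial>\<nu> j))"
    using le int by (subst nn_integral_eq_integral[symmetric]) simp_all
  then show "(\<integral>x. \<bar>f (X j x)\<bar> \<partial>\<pi> (m * K + k)) \<le> C * (\<integral>y. \<bar>f y\<bar> \<partial>\<nu> j)"
    using C_ge(1) by (subst (asm) ennreal_le_iff) (auto intro!: mult_nonneg_nonneg)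
qed

lemma b_int: "1 \<le> n \<Longrightarrow> n mod K + 1 < K \<Longrightarrow> integrable (\<nu> (n mod K)) (\<lambda>y. (a n y - 1)\<^sup>2)"
proof -
  assume n: "1 \<le> n" "n mod K + 1 < K"
  interpret prob_space "\<nu> (n mod K)" by (rule prob_\<nu>) simp
  show ?thesis
  proof (rule integrable_const_bound[of _ "(c + 1)\<^sup>2"])
    show "AE y in \<nu> (n mod K). norm ((a n y - 1)\<^sup>2) \<le> (c + 1)\<^sup>2"
    proof (rule AE_I2)
      fix y
      have "(a n y - 1)\<^sup>2 \<le> (c + 1)\<^sup>2"
        unfolding abs_le_square_iff[symmetric]
        using a_le[OF n, of y] a_pos(2)[of n y] c by linarith
      then show "norm ((a n y - 1)\<^sup>2) \<le> (c + 1)\<^sup>2" by simp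
    qed
  qed simp
qed

text \<open>With \<open>a\<close> bounded, the squared marginal errors inherit summability from the
  entropy decrements.\<close>

lemma b_le: "1 \<le> n \<Longrightarrow> n mod K + 1 < K \<Longrightarrow> b n \<le> (sqrt c + 1)\<^sup>2 * e n"
  unfolding b_def e_eq
  by (subst integral_mult_right_zero[symmetric])
    (intro integral_mono b_int integrable_mult_right gap_int minus_one_sq_le a_le; simp)

lemma b_nonneg: "0 \<le> b n"
  unfolding b_def by simp

lemma step_diff:
  assumes f[measurable]: "f \<in> borel_measurable N" and fi: "integrable (\<nu> j) f"
    and m: "1 \<le> m" and j: "j + 1 < K" and k: "k \<le> j"
  shows "integrable (\<pi> (Suc (m * K + k))) (\<lambda>x. f (X j x) * (a (m * K + k) (X k x) - 1))"
    and "\<Delta> m j k f = (\<integral>x. f (X j x) \<partial>\<pi> (m * K + k)) - (\<integral>x. f (X j x) \<partial>\<pi> (m * K + Suc k))"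
proof -
  have Xj[measurable]: "X j \<in> measurable P N" using j by (intro X) simp
  have k': "(m * K + k) mod K = k" "k mod K = k" using j k by simp_all
  have 1: "integrable (\<pi> (Suc (m * K + k))) (\<lambda>x. a (m * K + k) (X k x) * f (X j x))"
    using dominated_marginal(1)[OF f fi m j, of k] k
      integrable_\<pi>_iff_Suc[of "\<lambda>x. f (X j x)" "m * K + k"] by (simp add: k')
  have 2: "integrable (\<pi> (Suc (m * K + k))) (\<lambda>x. f (X j x))"
    using dominated_marginal(1)[OF f fi m j, of "Suc k"] k by simp
  have eq: "f (X j x) * (a (m * K + k) (X k x) - 1) = a (m * K + k) (X k x) * f (X j x) - f (X j x)" for x
    by (simp add: algebra_simps)
  show "integrable (\<pi> (Suc (m * K + k))) (\<lambda>x. f (X j x) * (a (m * K + k) (X k x) - 1))"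
    unfolding eq by (intro Bochner_Integration.integrable_diff 1 2)
  show "\<Delta> m j k f = (\<integral>x. f (X j x) \<partial>\<pi> (m * K + k)) - (\<integral>x. f (X j x) \<partial>\<pi> (m * K + Suc k))"
    unfolding \<Delta>_def eq Bochner_Integration.integral_diff[OF 1 2]
    using integral_\<pi>_Suc[of "\<lambda>x. f (X j x)" "m * K + k"] by (simp add: k')
qed

text \<open>Step \<open>j\<close> makes marginal \<open>j\<close> exact, so its error at the start
  of the cycle is the sum of the changes up to and including that step.\<close>

lemma telescope:
  assumes f[measurable]: "f \<in> borel_measurable N" and fi: "integrable (\<nu> j) f"
    and m: "1 \<le> m" and j: "j + 1 < K"
  shows "(\<integral>x. f (X j x) \<partial>\<pi> (m * K)) - (\<integral>y. f y \<partial>\<nu> j) = (\<Sum>k<Suc j. \<Delta> m j k f)"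
proof -
  define R where "R k = (\<integral>x. f (X j x) \<partial>\<pi> (m * K + k))" for k
  have "(\<Sum>k<Suc j. \<Delta> m j k f) = (\<Sum>k<Suc j. R k - R (Suc k))"
    unfolding R_def by (intro sum.cong step_diff(2) f fi m j) auto
  also have "\<dots> = R 0 - R (Suc j)"
    by (rule sum_lessThan_telescope')
  also have "R (Suc j) = (\<integral>y. f y \<partial>\<nu> j)"
    using integral_\<nu>[OF f, of "m * K + j"] j by (simp add: R_def)
  finally show ?thesis by (simp add: R_def)
qed

text \<open>The final step of the preceding cycle has just corrected this coordinate, so the one
  coordinate without a bound on \<open>a\<close> carries no error at cycle ends.\<close>

lemma telescope_last:
  fixes f :: "'a \<Rightarrow> real"
  assumes f[measurable]: "f \<in> borel_measurable N" and m: "1 \<le> m"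
  shows "(\<integral>x. f (X (K - 1) x) \<partial>\<pi> (m * K)) = (\<integral>y. f y \<partial>\<nu> (K - 1))"
    and "integrable (\<nu> (K - 1)) f \<Longrightarrow> integrable (\<pi> (m * K)) (\<lambda>x. f (X (K - 1) x))"
proof -
  have S: "Suc ((m - 1) * K + (K - 1)) = m * K"
    using K m by (cases m) auto
  have "((m - 1) * K + (K - 1)) mod K = K - 1" using K by (intro cycle_mod) simp
  then show "(\<integral>x. f (X (K - 1) x) \<partial>\<pi> (m * K)) = (\<integral>y. f y \<partial>\<nu> (K - 1))"
    "integrable (\<nu> (K - 1)) f \<Longrightarrow> integrable (\<pi> (m * K)) (\<lambda>x. f (X (K - 1) x))"
    using integral_\<nu>[OF f, of "(m - 1) * K + (K - 1)"] integrable_\<nu>_iff[OF f, of "(m - 1) * K + (K - 1)"]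
    unfolding S by simp_all
qed

lemma \<Delta>_add:
  assumes "f \<in> borel_measurable N" "integrable (\<nu> j) f" "g \<in> borel_measurable N" "integrable (\<nu> j) g"
    "1 \<le> m" "j + 1 < K" "k \<le> j"
  shows "\<Delta> m j k (\<lambda>y. f y + g y) = \<Delta> m j k f + \<Delta> m j k g"
  unfolding \<Delta>_def distrib_right
  by (rule Bochner_Integration.integral_add) (rule step_diff(1) assms)+

text \<open>AM-GM with weight \<open>t\<close>: the square of \<open>f\<close> passes to
  \<open>\<nu> j\<close> at the cost \<open>C\<close>, and the square of the error is exactly
  \<open>b\<close>, since marginal \<open>k\<close> is correct after step \<open>k\<close>.\<close>

lemma \<Delta>_le_square:
  assumes f[measurable]: "f \<in> borel_measurable N" and fi: "integrable (\<nu> j) f"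
    and f2: "integrable (\<nu> j) (\<lambda>y. (f y)\<^sup>2)"
    and m: "1 \<le> m" and j: "j + 1 < K" and k: "k \<le> j" and t: "0 < t"
  shows "\<bar>\<Delta> m j k f\<bar> \<le> (t * (C * (\<integral>y. (f y)\<^sup>2 \<partial>\<nu> j)) + b (m * K + k) / t) / 2"
proof -
  have Xj[measurable]: "X j \<in> measurable P N" using j by (intro X) simp
  have Xk[measurable]: "X k \<in> measurable P N" using j k by (intro X) simp
  have k': "(m * K + k) mod K = k" "k mod K = k" using j k by simp_all
  have n: "1 \<le> m * K + k" "(m * K + k) mod K + 1 < K" using one_le_cycle[OF m] j k by (simp_all add: k')
  let ?p = "\<pi> (Suc (m * K + k))"
  have i1: "integrable ?p (\<lambda>x. (f (X j x))\<^sup>2)"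
    using dominated_marginal(1)[OF _ f2 m j, of "Suc k"] k by simp
  have i2: "integrable ?p (\<lambda>x. (a (m * K + k) (X k x) - 1)\<^sup>2)"
    using b_int[OF n] integrable_\<nu>_iff[of "\<lambda>y. (a (m * K + k) y - 1)\<^sup>2" "m * K + k"] by (simp add: k')
  have v1: "(\<integral>x. (f (X j x))\<^sup>2 \<partial>?p) \<le> C * (\<integral>y. (f y)\<^sup>2 \<partial>\<nu> j)"
    using dominated_marginal(2)[OF _ f2 m j, of "Suc k"] k by simp
  have v2: "(\<integral>x. (a (m * K + k) (X k x) - 1)\<^sup>2 \<partial>?p) = b (m * K + k)"
    unfolding b_def using integral_\<nu>[of "\<lambda>y. (a (m * K + k) y - 1)\<^sup>2" "m * K + k"] by (simp add: k')
  have "\<bar>\<Delta> m j k f\<bar> \<le> (\<integral>x. \<bar>f (X j x) * (a (m * K + k) (X k x) - 1)\<bar> \<partial>?p)"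
    unfolding \<Delta>_def by (rule integral_abs_bound)
  also have "\<dots> \<le> (\<integral>x. (t * (f (X j x))\<^sup>2 + (a (m * K + k) (X k x) - 1)\<^sup>2 / t) / 2 \<partial>?p)"
    by (intro integral_mono integrable_abs step_diff(1) f fi m j k integrable_divide
        Bochner_Integration.integrable_add integrable_mult_right i1 i2 abs_mult_le_weighted_squares t)
  also have "\<dots> = (t * (\<integral>x. (f (X j x))\<^sup>2 \<partial>?p) + b (m * K + k) / t) / 2"
    using i1 i2 by (simp add: v2)
  also have "\<dots> \<le> (t * (C * (\<integral>y. (f y)\<^sup>2 \<partial>\<nu> j)) + b (m * K + k) / t) / 2"
    using v1 t by (intro divide_right_mono add_right_mono mult_left_mono) auto
  finally show ?thesis .
qed

text \<open>For \<open>f\<close> merely integrable: AM-GM applies to the part of \<open>f\<close>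
  truncated at \<open>R\<close>, and the excess is paired with the pointwise bound
  \<open>c + 1\<close> of the error. At \<open>R = 0\<close> this is a pure L1 estimate up to
  \<open>t / 2\<close>.\<close>

lemma \<Delta>_le_L1:
  assumes f[measurable]: "f \<in> borel_measurable N" and fi: "integrable (\<nu> j) f"
    and m: "1 \<le> m" and j: "j + 1 < K" and k: "k \<le> j" and t: "0 < t" and R: "0 \<le> R"
  shows "\<bar>\<Delta> m j k f\<bar> \<le> (t + R\<^sup>2 * b (m * K + k) / t) / 2
      + (c + 1) * (C * (\<integral>y. max 0 (\<bar>f y\<bar> - R) \<partial>\<nu> j))"
proof -
  interpret prob_space "\<nu> j" using j by (intro prob_\<nu>) simp
  have Xj[measurable]: "X j \<in> measurable P N" using j by (intro X) simp
  have Xk[measurable]: "X k \<in> measurable P N" using j k by (intro X) simp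
  have k': "(m * K + k) mod K = k" "k mod K = k" using j k by simp_all
  have n: "1 \<le> m * K + k" "(m * K + k) mod K + 1 < K" using one_le_cycle[OF m] j k by (simp_all add: k')
  let ?p = "\<pi> (Suc (m * K + k))"
  interpret p: prob_space ?p by (rule prob_\<pi>)
  let ?g = "\<lambda>y. max 0 (\<bar>f y\<bar> - R)"
  have gi: "integrable (\<nu> j) ?g"
    using fi j by (intro integrable_max) simp_all
  have i1: "integrable ?p (\<lambda>x. ?g (X j x))"
    using dominated_marginal(1)[OF _ gi m j, of "Suc k"] k by simp
  have i2: "integrable ?p (\<lambda>x. (a (m * K + k) (X k x) - 1)\<^sup>2)"
    using b_int[OF n] integrable_\<nu>_iff[of "\<lambda>y. (a (m * K + k) y - 1)\<^sup>2" "m * K + k"] by (simp add: k')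
  have v1: "(\<integral>x. ?g (X j x) \<partial>?p) \<le> C * (\<integral>y. ?g y \<partial>\<nu> j)"
    using dominated_marginal(2)[OF _ gi m j, of "Suc k"] k by simp
  have v2: "(\<integral>x. (a (m * K + k) (X k x) - 1)\<^sup>2 \<partial>?p) = b (m * K + k)"
    unfolding b_def using integral_\<nu>[of "\<lambda>y. (a (m * K + k) y - 1)\<^sup>2" "m * K + k"] by (simp add: k')
  have pw: "\<bar>f (X j x) * (a (m * K + k) (X k x) - 1)\<bar> \<le>
      (t + R\<^sup>2 * (a (m * K + k) (X k x) - 1)\<^sup>2 / t) / 2 + (c + 1) * ?g (X j x)" for x
  proof -
    define u where "u = \<bar>a (m * K + k) (X k x) - 1\<bar>"
    have u: "0 \<le> u" "u \<le> c + 1"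
      using a_le[OF n, of "X k x"] a_pos(2)[of "m * K + k" "X k x"] c unfolding u_def by linarith+
    have "\<bar>f (X j x) * (a (m * K + k) (X k x) - 1)\<bar> = u * \<bar>f (X j x)\<bar>"
      by (simp add: u_def abs_mult)
    also have "\<dots> \<le> u * (R + ?g (X j x))"
      using u by (intro mult_left_mono) auto
    also have "\<dots> = \<bar>1 * (R * u)\<bar> + u * ?g (X j x)"
      using u R by (simp add: algebra_simps)
    also have "\<dots> \<le> (t * 1\<^sup>2 + (R * u)\<^sup>2 / t) / 2 + (c + 1) * ?g (X j x)"
      using u by (intro add_mono abs_mult_le_weighted_squares t mult_right_mono) auto
    finally show ?thesis by (simp add: u_def power_mult_distrib)
  qed
  have "\<bar>\<Delta> m j k f\<bar> \<le> (\<integral>x. \<bar>f (X j x) * (a (m * K + k) (X k x) - 1)\<bar> \<partial>?p)"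
    unfolding \<Delta>_def by (rule integral_abs_bound)
  also have "\<dots> \<le> (\<integral>x. (t + R\<^sup>2 * (a (m * K + k) (X k x) - 1)\<^sup>2 / t) / 2 + (c + 1) * ?g (X j x) \<partial>?p)"
    by (intro integral_mono integrable_abs step_diff(1) f fi m j k integrable_divide
        Bochner_Integration.integrable_add integrable_mult_right i1 i2 pw p.integrable_const)
  also have "\<dots> = (\<integral>x. (t + R\<^sup>2 * (a (m * K + k) (X k x) - 1)\<^sup>2 / t) / 2 \<partial>?p) + (\<integral>x. (c + 1) * ?g (X j x) \<partial>?p)"
    by (intro Bochner_Integration.integral_add integrable_divide
        Bochner_Integration.integrable_add integrable_mult_right i1 i2 p.integrable_const)
  also have "\<dots> = (t + R\<^sup>2 * b (m * K + k) / t) / 2 + (c + 1) * (\<integral>x. ?g (X j x) \<partial>?p)"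
    using i2 by (simp add: v2)
  also have "\<dots> \<le> (t + R\<^sup>2 * b (m * K + k) / t) / 2 + (c + 1) * (C * (\<integral>y. ?g y \<partial>\<nu> j))"
    using v1 c by (intro add_left_mono mult_left_mono) auto
  finally show ?thesis .
qed

text \<open>\<open>F m j\<close> is the accumulated log-potential of coordinate \<open>j\<close> after \<open>m\<close> cycles, and \<open>A m\<close> is the defect
  in \<open>KL(\<pi> (m * K) | P) = KL(\<pi>\<^sup>\<star> | P) - KL(\<pi>\<^sup>\<star> | \<pi> (m * K))\<close>, an identity which would
  hold if all marginals were exact. From cycle \<open>m1\<close> on, each \<open>d = - ln a\<close> is split as
  \<open>(a - 1 - ln a) + (1 - a)\<close>: the parts \<open>\<Phi>\<close> are summable in \<open>L\<^sup>1\<close>, the parts \<open>G\<close> are bounded.\<close>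

definition F :: "nat \<Rightarrow> nat \<Rightarrow> 'a \<Rightarrow> real" where
  "F m j y = (\<Sum>i<m. d (i * K + j) y)"

definition A :: "nat \<Rightarrow> real" where
  "A m = (\<integral>x. H (m * K) x \<partial>\<pi> (m * K)) - (\<Sum>i<m * K. e i)"

text \<open>A summable bound for the squared errors of one cycle. The geometric term keeps it
  strictly positive, so that it can serve as a divisor in AM-GM weights.\<close>

definition E :: "nat \<Rightarrow> real" where
  "E m = (sqrt c + 1)\<^sup>2 * (\<Sum>j<K. e (m * K + j)) + (1 / 2) ^ m"

definition \<Phi> :: "nat \<Rightarrow> nat \<Rightarrow> nat \<Rightarrow> 'a \<Rightarrow> real" where
  "\<Phi> m1 m j y = (\<Sum>i\<in>{m1..<m}. a (i * K + j) y - 1 - ln (a (i * K + j) y))"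

definition G :: "nat \<Rightarrow> nat \<Rightarrow> nat \<Rightarrow> 'a \<Rightarrow> real" where
  "G m1 m j y = (\<Sum>i\<in>{m1..<m}. 1 - a (i * K + j) y)"

section \<open>The defect as a sum of single-step changes\<close>

lemma H_cycle: "H (m * K) x = (\<Sum>j<K. F m j (X j x))"
proof -
  have "H (m * K) x = (\<Sum>i<m. \<Sum>j<K. d (i * K + j) (X j x))"
    unfolding H_def sum_lessThan_mult by (intro sum.cong) simp_all
  also have "\<dots> = (\<Sum>j<K. F m j (X j x))"
    unfolding F_def by (rule sum.swap)
  finally show ?thesis .
qed

lemma F_measurable[measurable]: "F m j \<in> borel_measurable N"
  unfolding F_def by measurable

lemma F_int: "j < K \<Longrightarrow> integrable (\<nu> j) (F m j)"
  and F_integral: "j < K \<Longrightarrow> (\<integral>y. F m j y \<partial>\<nu> j) = (\<Sum>i<m. e (i * K + j))"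
  unfolding F_def using d_int[of "_ * K + j"]
  by (auto simp: e_def intro!: Bochner_Integration.integrable_sum Bochner_Integration.integral_sum)

lemma F_int_\<pi>:
  assumes m: "1 \<le> m" and j: "j < K"
  shows "integrable (\<pi> (m * K)) (\<lambda>x. F m j (X j x))"
proof (cases "j + 1 < K")
  case True
  then show ?thesis
    using dominated_marginal(1)[OF F_measurable F_int[OF j] m True, of 0] by simp
next
  case False
  then have "j = K - 1" using j by simp
  then show ?thesis
    using telescope_last(2)[OF F_measurable m] F_int[OF j] by simp
qed

lemma H_int: "1 \<le> m \<Longrightarrow> integrable (\<pi> (m * K)) (H (m * K))"
  unfolding H_cycle[abs_def] using F_int_\<pi> by (intro Bochner_Integration.integrable_sum) auto

text \<open>Both terms of \<open>A\<close> split over coordinates into integrals of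
  \<open>F m j\<close>, one against the actual marginal and one against the target. Their difference
  is a marginal error, which telescopes over the next cycle.\<close>

lemma A_eq:
  assumes m: "1 \<le> m"
  shows "A m = (\<Sum>j<K - 1. \<Sum>k<Suc j. \<Delta> m j k (F m j))"
proof -
  let ?D = "\<lambda>j. (\<integral>x. F m j (X j x) \<partial>\<pi> (m * K)) - (\<integral>y. F m j y \<partial>\<nu> j)"
  have "(\<Sum>i<m * K. e i) = (\<Sum>j<K. \<integral>y. F m j y \<partial>\<nu> j)"
    unfolding sum_lessThan_mult by (subst sum.swap) (simp add: F_integral)
  then have "A m = (\<Sum>j<K. ?D j)"
    unfolding A_def H_cycle using F_int_\<pi>[OF m]
    by (subst Bochner_Integration.integral_sum) (simp_all add: sum_subtractf)
  \<comment> \<open>The last coordinate drops out, its marginal being exact at the end of a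
    cycle.\<close>
  also have "{..<K} = insert (K - 1) {..<K - 1}"
    using K by auto
  also have "(\<Sum>j\<in>insert (K - 1) {..<K - 1}. ?D j) = (\<Sum>j<K - 1. ?D j)"
    using telescope_last(1)[OF F_measurable m, of m "K - 1"] by simp
  also have "\<dots> = (\<Sum>j<K - 1. \<Sum>k<Suc j. \<Delta> m j k (F m j))"
    using m by (intro sum.cong telescope F_int F_measurable) auto
  finally show ?thesis .
qed

lemma cycle_sum_summable: "summable (\<lambda>m. \<Sum>j<K. e (m * K + j))"
  by (rule summableI_nonneg_bounded[of _ I])
    (auto intro: sum_nonneg e_nonneg simp: sum_lessThan_mult[symmetric] sum_e_le)

lemma E_summable: "summable E"
  unfolding E_def[abs_def] by (intro summable_add summable_mult cycle_sum_summable summable_geometric) simp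

lemma E_pos: "0 < E m"
  unfolding E_def by (intro add_nonneg_pos mult_nonneg_nonneg sum_nonneg e_nonneg) auto

lemma sum_b_le_E: "1 \<le> m \<Longrightarrow> (\<Sum>j<K - 1. b (m * K + j)) \<le> E m"
proof -
  assume m: "1 \<le> m"
  have "(\<Sum>j<K - 1. b (m * K + j)) \<le> (\<Sum>j<K - 1. (sqrt c + 1)\<^sup>2 * e (m * K + j))"
    using m by (intro sum_mono b_le one_le_cycle) auto
  also have "\<dots> \<le> (\<Sum>j<K. (sqrt c + 1)\<^sup>2 * e (m * K + j))"
    by (intro sum_mono2) (auto intro: mult_nonneg_nonneg e_nonneg)
  also have "\<dots> \<le> E m"
    unfolding E_def sum_distrib_left[symmetric] by simp
  finally show ?thesis .
qed

lemma b_le_E: "1 \<le> m \<Longrightarrow> k + 1 < K \<Longrightarrow> b (m * K + k) \<le> E m"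
  by (rule order_trans[OF member_le_sum sum_b_le_E]) (auto simp: b_nonneg)

lemma b_tendsto: "k + 1 < K \<Longrightarrow> (\<lambda>m. b (m * K + k)) \<longlonglongrightarrow> 0"
  by (rule Lim_null_comparison[OF _ summable_LIMSEQ_zero[OF E_summable]])
    (auto intro!: eventually_sequentiallyI[of 1] simp: b_le_E b_nonneg)

text \<open>The truncation level is fixed before \<open>m\<close> grows: integrability of
  \<open>f\<close> handles the excess, and convergence of \<open>b\<close> to 0 handles the bounded
  part.\<close>

lemma \<Delta>_fixed_small:
  assumes f: "f \<in> borel_measurable N" "integrable (\<nu> j) f" and j: "j + 1 < K" and k: "k \<le> j" and \<epsilon>: "0 < \<epsilon>"
  shows "\<forall>\<^sub>F m in sequentially. \<bar>\<Delta> m j k f\<bar> \<le> \<epsilon>"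
proof -
  interpret prob_space "\<nu> j" using j by (intro prob_\<nu>) simp
  have "(\<lambda>n. (c + 1) * (C * (\<integral>y. max 0 (\<bar>f y\<bar> - real n) \<partial>\<nu> j))) \<longlonglongrightarrow> (c + 1) * (C * 0)"
    by (intro tendsto_intros integral_excess_tendsto f)
  then have "\<forall>\<^sub>F n in sequentially. (c + 1) * (C * (\<integral>y. max 0 (\<bar>f y\<bar> - real n) \<partial>\<nu> j)) < \<epsilon> / 2"
    using \<epsilon> by (intro order_tendstoD) auto
  then obtain n where n: "(c + 1) * (C * (\<integral>y. max 0 (\<bar>f y\<bar> - real n) \<partial>\<nu> j)) < \<epsilon> / 2"
    by (auto simp: eventually_sequentially)
  have "(\<lambda>m. (\<epsilon> / 2 + (real n)\<^sup>2 * b (m * K + k) / (\<epsilon> / 2)) / 2) \<longlonglongrightarrow> (\<epsilon> / 2 + (real n)\<^sup>2 * 0 / (\<epsilon> / 2)) / 2"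
    using j k \<epsilon> by (intro tendsto_intros b_tendsto) auto
  then have "\<forall>\<^sub>F m in sequentially. (\<epsilon> / 2 + (real n)\<^sup>2 * b (m * K + k) / (\<epsilon> / 2)) / 2 < \<epsilon> / 2"
    using \<epsilon> by (intro order_tendstoD) auto
  then show ?thesis
    using eventually_ge_at_top[of 1]
  proof eventually_elim
    case (elim m)
    have "\<bar>\<Delta> m j k f\<bar> \<le> (\<epsilon> / 2 + (real n)\<^sup>2 * b (m * K + k) / (\<epsilon> / 2)) / 2
        + (c + 1) * (C * (\<integral>y. max 0 (\<bar>f y\<bar> - real n) \<partial>\<nu> j))"
      using \<epsilon> by (intro \<Delta>_le_L1 f elim(2) j k) simp_all
    also have "\<dots> \<le> \<epsilon> / 2 + \<epsilon> / 2"
      by (intro add_mono less_imp_le elim(1) n)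
    finally show ?case by simp
  qed
qed

section \<open>The convergent and the quadratic part of the potentials\<close>

lemma \<Phi>_measurable[measurable]: "\<Phi> m1 m j \<in> borel_measurable N"
  and G_measurable[measurable]: "G m1 m j \<in> borel_measurable N"
  unfolding \<Phi>_def G_def by measurable

lemma \<Phi>_int: "j < K \<Longrightarrow> integrable (\<nu> j) (\<Phi> m1 m j)"
  and \<Phi>_integral: "j < K \<Longrightarrow> (\<integral>y. \<Phi> m1 m j y \<partial>\<nu> j) = (\<Sum>i\<in>{m1..<m}. e (i * K + j))"
  unfolding \<Phi>_def using gap_int[of "_ * K + j"]
  by (auto simp: e_eq intro!: Bochner_Integration.integrable_sum Bochner_Integration.integral_sum)

lemma \<Phi>_nonneg: "0 \<le> \<Phi> m1 m j y"
  unfolding \<Phi>_def by (intro sum_nonneg) (use ln_le_minus_one[of "a _ y"] in simp)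

text \<open>It serves square-integrability only; a bound growing with \<open>m\<close> would be
  useless in the estimates.\<close>

lemma G_bound:
  assumes "1 \<le> m1" "j + 1 < K"
  shows "\<bar>G m1 m j y\<bar> \<le> real (m - m1) * (c + 1)"
proof -
  have "\<bar>G m1 m j y\<bar> \<le> (\<Sum>i\<in>{m1..<m}. \<bar>1 - a (i * K + j) y\<bar>)"
    unfolding G_def by (rule sum_abs)
  also have "\<dots> \<le> (\<Sum>i\<in>{m1..<m}. c + 1)"
  proof (rule sum_mono)
    fix i assume "i \<in> {m1..<m}"
    then have "a (i * K + j) y \<le> c"
      using assms one_le_cycle[of i j] by (intro a_le) auto
    then show "\<bar>1 - a (i * K + j) y\<bar> \<le> c + 1"
      using a_pos(2)[of "i * K + j" y] c by linarith
  qed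
  finally show ?thesis by simp
qed

lemma G_int:
  assumes "1 \<le> m1" "j + 1 < K"
  shows "integrable (\<nu> j) (G m1 m j)" "integrable (\<nu> j) (\<lambda>y. (G m1 m j y)\<^sup>2)"
proof -
  interpret prob_space "\<nu> j" using assms by (intro prob_\<nu>) simp
  show "integrable (\<nu> j) (G m1 m j)"
    using G_bound[OF assms, of m] assms by (intro integrable_const_bound[of _ "real (m - m1) * (c + 1)"]) auto
  have "(G m1 m j y)\<^sup>2 \<le> (real (m - m1) * (c + 1))\<^sup>2" for y
    using power_mono[OF G_bound[OF assms, of m y], of 2] by simp
  then show "integrable (\<nu> j) (\<lambda>y. (G m1 m j y)\<^sup>2)"
    using assms by (intro integrable_const_bound[of _ "(real (m - m1) * (c + 1))\<^sup>2"]) auto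
qed

lemma F_decomp:
  assumes "m1 \<le> m"
  shows "F m j y = F m1 j y + \<Phi> m1 m j y + G m1 m j y"
proof -
  have "F m j y = F m1 j y + (\<Sum>i\<in>{m1..<m}. d (i * K + j) y)"
    unfolding F_def using sum.atLeastLessThan_concat[of 0 m1 m "\<lambda>i. d (i * K + j) y"] assms
    by (simp add: atLeast0LessThan)
  also have "(\<Sum>i\<in>{m1..<m}. d (i * K + j) y) = \<Phi> m1 m j y + G m1 m j y"
    unfolding \<Phi>_def G_def sum.distrib[symmetric] by (simp add: a_def)
  finally show ?thesis by simp
qed

text \<open>Summation by parts: \<open>G\<close> is integrated against its own increment.\<close>

lemma \<Delta>_G_diag:
  assumes m1: "1 \<le> m1" "m1 \<le> m" and j: "j + 1 < K"
  shows "\<Delta> m j j (G m1 m j) =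
    ((\<integral>y. (G m1 m j y)\<^sup>2 \<partial>\<nu> j) - (\<integral>y. (G m1 (Suc m) j y)\<^sup>2 \<partial>\<nu> j) + b (m * K + j)) / 2"
proof -
  have m: "1 \<le> m" using m1 by simp
  have bi: "integrable (\<nu> j) (\<lambda>y. (a (m * K + j) y - 1)\<^sup>2)"
    using b_int[of "m * K + j"] one_le_cycle[OF m, of j] j by simp
  \<comment> \<open>After step \<open>j\<close> the marginal \<open>j\<close> is
    \<open>\<nu> j\<close> itself, so the diagonal term is evaluated exactly and not merely
    estimated.\<close>
  have "\<Delta> m j j (G m1 m j) = (\<integral>y. G m1 m j y * (a (m * K + j) y - 1) \<partial>\<nu> j)"
    unfolding \<Delta>_def using integral_\<nu>[of "\<lambda>y. G m1 m j y * (a (m * K + j) y - 1)" "m * K + j"] j by simp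
  also have "\<dots> = (\<integral>y. ((G m1 m j y)\<^sup>2 - (G m1 (Suc m) j y)\<^sup>2 + (a (m * K + j) y - 1)\<^sup>2) / 2 \<partial>\<nu> j)"
  proof (rule Bochner_Integration.integral_cong[OF refl])
    fix y
    have eq: "G m1 (Suc m) j y = G m1 m j y + (1 - a (m * K + j) y)"
      using m1 by (simp add: G_def)
    show "G m1 m j y * (a (m * K + j) y - 1) =
        ((G m1 m j y)\<^sup>2 - (G m1 (Suc m) j y)\<^sup>2 + (a (m * K + j) y - 1)\<^sup>2) / 2"
      unfolding eq by (simp add: power2_eq_square algebra_simps)
  qed
  also have "\<dots> = ((\<integral>y. (G m1 m j y)\<^sup>2 \<partial>\<nu> j) - (\<integral>y. (G m1 (Suc m) j y)\<^sup>2 \<partial>\<nu> j) + b (m * K + j)) / 2"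
    using G_int[OF m1(1) j] bi j by (simp add: b_def)
  finally show ?thesis .
qed

text \<open>The potential up to cycle \<open>m1\<close> is a fixed function, covered by
  \<open>base\<close>. The L1 norm of \<open>\<Phi>\<close> is a tail of entropy decrements, so
  \<open>\<Delta>_le_L1\<close> with \<open>R = 0\<close> and \<open>t = \<epsilon>\<close> costs
  another \<open>\<epsilon>\<close>.\<close>

lemma \<Delta>_F_le:
  assumes m1: "1 \<le> m1" "m1 \<le> m" and j: "j + 1 < K" and k: "k \<le> j"
    and base: "\<bar>\<Delta> m j k (F m1 j)\<bar> \<le> \<epsilon>" and \<epsilon>: "0 < \<epsilon>"
    and tail: "(c + 1) * (C * (\<Sum>i\<in>{m1..<m}. e (i * K + j))) \<le> \<epsilon> / 2"
  shows "\<Delta> m j k (F m j) \<le> 2 * \<epsilon> + \<Delta> m j k (G m1 m j)"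
proof -
  have m: "1 \<le> m" using m1 by simp
  have jK: "j < K" using j by simp
  note ints = F_measurable F_int[OF jK] \<Phi>_measurable \<Phi>_int[OF jK] G_measurable G_int(1)[OF m1(1) j]
  have F: "F m j = (\<lambda>y. (F m1 j y + \<Phi> m1 m j y) + G m1 m j y)"
    using F_decomp[OF m1(2)] by auto
  have "\<Delta> m j k (F m j) = \<Delta> m j k (\<lambda>y. F m1 j y + \<Phi> m1 m j y) + \<Delta> m j k (G m1 m j)"
    unfolding F by (rule \<Delta>_add[OF borel_measurable_add[OF ints(1,3)]
        Bochner_Integration.integrable_add[OF ints(2,4)] ints(5,6) m j k])
  moreover have "\<Delta> m j k (\<lambda>y. F m1 j y + \<Phi> m1 m j y) = \<Delta> m j k (F m1 j) + \<Delta> m j k (\<Phi> m1 m j)"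
    by (rule \<Delta>_add[OF ints(1-4) m j k])
  moreover have "\<Delta> m j k (\<Phi> m1 m j) \<le> \<epsilon> / 2 + (c + 1) * (C * (\<Sum>i\<in>{m1..<m}. e (i * K + j)))"
    using \<Delta>_le_L1[OF \<Phi>_measurable \<Phi>_int[OF jK] m j k \<epsilon>, of 0 m1 m]
    by (simp add: \<Phi>_nonneg \<Phi>_integral[OF jK] max_absorb2)
  ultimately show ?thesis
    using base tail by linarith
qed

text \<open>If \<open>A\<close> stayed above \<open>\<delta>\<close>, then the squared norms of the \<open>G\<close> parts would eventually decrease by about
  \<open>\<delta>\<close> in every cycle. The off-diagonal terms are absorbed by the weighted AM-GM inequality with the
  summable weight \<open>\<theta> * E m\<close>.\<close>

lemma exists_small_A:
  assumes \<delta>: "0 < \<delta>"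
  shows "\<exists>m\<ge>m0. A m \<le> \<delta>"
proof (rule ccontr)
  assume "\<not> (\<exists>m\<ge>m0. A m \<le> \<delta>)"
  then have big: "\<delta> < A m" if "m0 \<le> m" for m
    using that by (meson not_le)
  \<comment> \<open>The constants make \<open>2 * K\<^sup>2 * \<epsilon>\<close> and
    \<open>K\<^sup>2 / (2 * \<theta>)\<close> both equal to \<open>\<delta> / 4\<close>. This leaves
    \<open>\<delta> / 2\<close>, which becomes the drift \<open>\<delta>\<close> once the factor 1/2
    in front of the squares is cleared.\<close>
  define \<epsilon> where "\<epsilon> = \<delta> / (8 * (real K)\<^sup>2)"
  define \<theta> where "\<theta> = 2 * (real K)\<^sup>2 / \<delta>"
  have K0: "0 < real K" using K by simp
  have \<epsilon>: "0 < \<epsilon>" and \<theta>: "0 < \<theta>" using \<delta> K0 by (simp_all add: \<epsilon>_def \<theta>_def)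
  have cC: "0 < (c + 1) * C" using c C_ge(1) by simp
  obtain M where M: "\<And>m n. M \<le> m \<Longrightarrow> norm (\<Sum>i=m..n. \<Sum>j<K. e (i * K + j)) < \<epsilon> / 2 / ((c + 1) * C)"
    using summable_partial_sum_bound[OF cycle_sum_summable, of "\<epsilon> / 2 / ((c + 1) * C)"] \<epsilon> cC by auto
  \<comment> \<open>Starting at cycle 1 or later avoids step 0, for which no bound on
    \<open>a\<close> is available.\<close>
  define m1 where "m1 = max 1 M"
  have m1: "1 \<le> m1" "M \<le> m1" by (simp_all add: m1_def)
  have tail: "(c + 1) * (C * (\<Sum>i\<in>{m1..<m}. e (i * K + j))) \<le> \<epsilon> / 2" if "j < K" for m j
  proof (cases "m1 < m")
    case True
    then have eq: "{m1..<m} = {m1..m - 1}" by auto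
    have "(\<Sum>i\<in>{m1..<m}. e (i * K + j)) \<le> (\<Sum>i\<in>{m1..<m}. \<Sum>j<K. e (i * K + j))"
      using that by (intro sum_mono member_le_sum[of j "{..<K}"]) (auto intro: e_nonneg)
    also have "\<dots> < \<epsilon> / 2 / ((c + 1) * C)"
      using M[OF m1(2), of "m - 1"] unfolding eq by (simp add: abs_less_iff)
    finally show ?thesis
      using cC by (simp add: field_simps)
  qed (use \<epsilon> in simp)
  \<comment> \<open>The order of choices matters: only with \<open>m1\<close> fixed are the
    \<open>F m1 j\<close> finitely many fixed functions, to which
    \<open>\<Delta>_fixed_small\<close> applies.\<close>
  have "\<forall>\<^sub>F m in sequentially. \<forall>j\<in>{..<K - 1}. \<forall>k\<in>{..j}. \<bar>\<Delta> m j k (F m1 j)\<bar> \<le> \<epsilon>"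
    by (intro eventually_ball_finite ballI \<Delta>_fixed_small F_measurable F_int \<epsilon>) auto
  then obtain m2 where m2: "\<And>m j k. m2 \<le> m \<Longrightarrow> j < K - 1 \<Longrightarrow> k \<le> j \<Longrightarrow> \<bar>\<Delta> m j k (F m1 j)\<bar> \<le> \<epsilon>"
    by (auto simp: eventually_sequentially)
  define q where "q m j = (\<integral>y. (G m1 m j y)\<^sup>2 \<partial>\<nu> j)" for m j
  define Q where "Q m = (\<Sum>j<K - 1. q m j)" for m
  have q0: "0 \<le> q m j" for m j by (simp add: q_def)
  show False
  proof (rule no_positive_drift)
    show "0 \<le> Q m" for m unfolding Q_def by (intro sum_nonneg q0)
    show "0 \<le> E m" for m using E_pos[of m] by simp
    show "summable E" by (rule E_summable)
    show "0 \<le> real K * \<theta> * C" using \<theta> C_ge(1) by simp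
    show "0 < \<delta>" by (rule \<delta>)
    fix m assume m: "max m0 (max m1 m2) \<le> m"
    then have m': "1 \<le> m" "m1 \<le> m" "m2 \<le> m" "m0 \<le> m" using m1 by auto
    have off: "\<Delta> m j k (G m1 m j) \<le> (\<theta> * (C * (E m * q m j)) + 1 / \<theta>) / 2" if j: "j + 1 < K" and k: "k < j" for j k
    proof -
      have "\<Delta> m j k (G m1 m j) \<le> (\<theta> * E m * (C * q m j) + b (m * K + k) / (\<theta> * E m)) / 2"
        using \<Delta>_le_square[OF G_measurable G_int[OF m1(1) j] m'(1) j, of k "\<theta> * E m" m] \<theta> E_pos[of m] k
        by (simp add: q_def)
      \<comment> \<open>The weight is matched to \<open>b \<le> E m\<close>: the error term becomes
        the small constant \<open>1 / \<theta>\<close>, while the coefficient of \<open>q\<close>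
        remains summable in \<open>m\<close>.\<close>
      also have "b (m * K + k) / (\<theta> * E m) \<le> E m / (\<theta> * E m)"
        using b_le_E[OF m'(1), of k] j k \<theta> E_pos[of m] by (intro divide_right_mono) auto
      also have "E m / (\<theta> * E m) = 1 / \<theta>"
        using E_pos[of m] by simp
      finally show ?thesis by (simp add: mult_ac)
    qed
    have row: "(\<Sum>k<Suc j. \<Delta> m j k (F m j)) \<le>
        2 * real K * \<epsilon> + (q m j - q (Suc m) j + b (m * K + j)) / 2 + real K * ((\<theta> * (C * (E m * q m j)) + 1 / \<theta>) / 2)"
      if "j < K - 1" for j
    proof -
      have j: "j + 1 < K" using that by simp
      have nn: "0 \<le> (\<theta> * (C * (E m * q m j)) + 1 / \<theta>) / 2"
        using \<theta> C_ge(1) E_pos[of m] q0[of m j] by simp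
      have "(\<Sum>k<Suc j. \<Delta> m j k (F m j)) \<le> (\<Sum>k<Suc j. 2 * \<epsilon> + \<Delta> m j k (G m1 m j))"
        using m2[OF m'(3) that] tail j by (intro sum_mono \<Delta>_F_le m1 m' \<epsilon>) auto
      also have "\<dots> = 2 * real (Suc j) * \<epsilon> + \<Delta> m j j (G m1 m j) + (\<Sum>k<j. \<Delta> m j k (G m1 m j))"
        by (simp add: sum.distrib algebra_simps)
      also have "(\<Sum>k<j. \<Delta> m j k (G m1 m j)) \<le> (\<Sum>k<j. (\<theta> * (C * (E m * q m j)) + 1 / \<theta>) / 2)"
        by (intro sum_mono off j) auto
      also have "\<dots> \<le> real K * ((\<theta> * (C * (E m * q m j)) + 1 / \<theta>) / 2)"
        using j mult_right_mono[OF _ nn, of "real j" "real K"] by simp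
      also have "2 * real (Suc j) * \<epsilon> \<le> 2 * real K * \<epsilon>"
        using j \<epsilon> by (intro mult_right_mono) auto
      also have "\<Delta> m j j (G m1 m j) = (q m j - q (Suc m) j + b (m * K + j)) / 2"
        unfolding q_def by (rule \<Delta>_G_diag[OF m1(1) m'(2) j])
      finally show ?thesis by simp
    qed
    have "\<delta> < A m" by (rule big[OF m'(4)])
    also have "A m \<le> (\<Sum>j<K - 1. 2 * real K * \<epsilon> + (q m j - q (Suc m) j + b (m * K + j)) / 2
        + real K * ((\<theta> * (C * (E m * q m j)) + 1 / \<theta>) / 2))"
      unfolding A_eq[OF m'(1)] by (intro sum_mono row) auto
    also have "\<dots> = real (K - 1) * (2 * real K * \<epsilon>) + (Q m - Q (Suc m) + (\<Sum>j<K - 1. b (m * K + j))) / 2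
        + real K * ((\<theta> * (C * (E m * Q m)) + real (K - 1) * (1 / \<theta>)) / 2)"
    proof -
      have 1: "(\<Sum>j<K - 1. 2 * real K * \<epsilon>) = real (K - 1) * (2 * real K * \<epsilon>)"
        by simp
      have 2: "(\<Sum>j<K - 1. (q m j - q (Suc m) j + b (m * K + j)) / 2) = (Q m - Q (Suc m) + (\<Sum>j<K - 1. b (m * K + j))) / 2"
        unfolding Q_def sum_divide_distrib[symmetric] sum.distrib sum_subtractf ..
      have "(\<Sum>j<K - 1. 1 / \<theta>) = real (K - 1) * (1 / \<theta>)"
        by simp
      then have 3: "(\<Sum>j<K - 1. real K * ((\<theta> * (C * (E m * q m j)) + 1 / \<theta>) / 2))
          = real K * ((\<theta> * (C * (E m * Q m)) + real (K - 1) * (1 / \<theta>)) / 2)"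
        unfolding Q_def sum_distrib_left[symmetric] sum_divide_distrib[symmetric] sum.distrib by simp
      show ?thesis
        unfolding sum.distrib[of _ _ "{..<K - 1}"] 1[symmetric] 2[symmetric] 3[symmetric]
        unfolding sum.distrib[symmetric] ..
    qed
    also have "\<dots> \<le> real K * (2 * real K * \<epsilon>) + (Q m - Q (Suc m) + E m) / 2
        + real K * ((\<theta> * (C * (E m * Q m)) + real K * (1 / \<theta>)) / 2)"
      using sum_b_le_E[OF m'(1)] \<theta> \<epsilon>
      by (intro add_mono mult_right_mono mult_left_mono divide_right_mono order_refl) auto
    also have "real K * (2 * real K * \<epsilon>) = \<delta> / 4"
      using K0 by (simp add: \<epsilon>_def power2_eq_square)
    also have "real K * ((\<theta> * (C * (E m * Q m)) + real K * (1 / \<theta>)) / 2) = real K * \<theta> * C * E m * Q m / 2 + \<delta> / 4"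
      using K0 \<delta> by (simp add: \<theta>_def power2_eq_square field_simps)
    finally show "Q (Suc m) \<le> (1 + real K * \<theta> * C * E m) * Q m + E m - \<delta>"
      by (simp add: field_simps)
  qed
qed

subsection \<open>Exhaustion of the entropy\<close>

lemma entropy_\<pi>:
  assumes m: "1 \<le> m"
  shows "integrable P (\<lambda>x. exp (H (m * K) x) * ln (exp (H (m * K) x)))"
    and "(\<integral>x. exp (H (m * K) x) * ln (exp (H (m * K) x)) \<partial>P) = A m + (\<Sum>i<m * K. e i)"
proof -
  show "integrable P (\<lambda>x. exp (H (m * K) x) * ln (exp (H (m * K) x)))"
    using H_int[OF m] unfolding \<pi>_density by (subst (asm) integrable_density) simp_all
  have "(\<integral>x. H (m * K) x \<partial>\<pi> (m * K)) = (\<integral>x. exp (H (m * K) x) * ln (exp (H (m * K) x)) \<partial>P)"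
    by (subst \<pi>_density, subst integral_density) simp_all
  then show "(\<integral>x. exp (H (m * K) x) * ln (exp (H (m * K) x)) \<partial>P) = A m + (\<Sum>i<m * K. e i)"
    by (simp add: A_def)
qed

text \<open>Telescoping applied to an indicator, whose square has integral at most 1; hence the
  bound is uniform in \<open>B\<close>.\<close>

lemma marginal_error:
  assumes m: "1 \<le> m" and j: "j < K" and B[measurable]: "B \<in> sets N" and t: "0 < t"
  shows "\<bar>(\<integral>x. indicator B (X j x) \<partial>\<pi> (m * K)) - measure (\<nu> j) B\<bar> \<le> real K * ((t * C + E m / t) / 2)"
proof (cases "j + 1 < K")
  case True
  interpret prob_space "\<nu> j" by (rule prob_\<nu>[OF j])
  have B': "B \<in> sets (\<nu> j)" using j by (simp add: sets_\<nu>)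
  have Bsp: "B \<inter> space (\<nu> j) = B" using B' sets.sets_into_space by blast
  have ind: "(indicator B :: 'a \<Rightarrow> real) \<in> borel_measurable N" "integrable (\<nu> j) (indicator B :: 'a \<Rightarrow> real)"
    "integrable (\<nu> j) (\<lambda>y. (indicator B y :: real)\<^sup>2)"
    using B' by (auto simp: indicator_def[abs_def] if_distrib power2_eq_square intro!: integrable_const_bound[of _ 1])
  have le1: "(\<integral>y. (indicator B y :: real)\<^sup>2 \<partial>\<nu> j) \<le> 1"
    using integral_mono[OF ind(3) integrable_const[of 1]] by (simp add: indicator_def prob_space)
  have nn: "0 \<le> (t * C + E m / t) / 2" using t C_ge(1) E_pos[of m] by simp
  have "\<bar>(\<integral>x. indicator B (X j x) \<partial>\<pi> (m * K)) - measure (\<nu> j) B\<bar> = \<bar>\<Sum>k<Suc j. \<Delta> m j k (indicator B)\<bar>"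
    using telescope[OF ind(1,2) m True] by (simp add: Bsp)
  also have "\<dots> \<le> (\<Sum>k<Suc j. \<bar>\<Delta> m j k (indicator B)\<bar>)"
    by (rule sum_abs)
  also have "\<dots> \<le> (\<Sum>k<Suc j. (t * C + E m / t) / 2)"
  proof (rule sum_mono)
    fix k assume "k \<in> {..<Suc j}"
    then have k: "k \<le> j" "k + 1 < K" using True by auto
    have "\<bar>\<Delta> m j k (indicator B)\<bar> \<le> (t * (C * (\<integral>y. (indicator B y :: real)\<^sup>2 \<partial>\<nu> j)) + b (m * K + k) / t) / 2"
      by (rule \<Delta>_le_square[OF ind m True k(1) t])
    also have "\<dots> \<le> (t * (C * 1) + E m / t) / 2"
      using t C_ge(1) le1 b_le_E[OF m k(2)]
      by (intro divide_right_mono add_mono mult_left_mono) auto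
    finally show "\<bar>\<Delta> m j k (indicator B)\<bar> \<le> (t * C + E m / t) / 2" by simp
  qed
  also have "\<dots> = real (Suc j) * ((t * C + E m / t) / 2)" by simp
  also have "\<dots> \<le> real K * ((t * C + E m / t) / 2)"
    using j nn by (intro mult_right_mono) auto
  finally show ?thesis .
next
  case False
  then have j': "j = K - 1" using j by simp
  have B': "B \<in> sets (\<nu> j)" using j by (simp add: sets_\<nu>)
  have Bsp: "B \<inter> space (\<nu> j) = B" using B' sets.sets_into_space by blast
  have "(\<integral>x. indicator B (X j x) \<partial>\<pi> (m * K)) = measure (\<nu> j) B"
    using telescope_last(1)[of "indicator B :: 'a \<Rightarrow> real", OF _ m] Bsp by (simp add: j')
  then show ?thesis
    using t C_ge(1) E_pos[of m] by simp
qed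

text \<open>The marginal errors are small for all large \<open>m\<close>, the defect only for
  infinitely many; \<open>exists_small_A\<close> beyond a given index provides a common one.\<close>

lemma nearly_feasible:
  assumes \<epsilon>: "0 < \<epsilon>"
  shows "\<exists>m\<ge>1. A m \<le> \<epsilon> \<and> (\<forall>j<K. \<forall>B\<in>sets N.
    \<bar>(\<integral>x. indicator B (X j x) \<partial>\<pi> (m * K)) - measure (\<nu> j) B\<bar> \<le> \<epsilon>)"
proof -
  \<comment> \<open>Chosen so that the first term of the marginal bound is
    \<open>\<epsilon> / 2\<close>; the second vanishes with \<open>E m\<close>.\<close>
  define t where "t = \<epsilon> / (real K * C)"
  have t: "0 < t" using \<epsilon> K C_ge(1) by (simp add: t_def)
  have "(\<lambda>m. real K * ((t * C + E m / t) / 2)) \<longlonglongrightarrow> real K * ((t * C + 0 / t) / 2)"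
    using t by (intro tendsto_intros summable_LIMSEQ_zero[OF E_summable]) auto
  moreover have "real K * ((t * C + 0 / t) / 2) < \<epsilon>"
    using \<epsilon> K C_ge(1) by (simp add: t_def)
  ultimately have "\<forall>\<^sub>F m in sequentially. real K * ((t * C + E m / t) / 2) < \<epsilon>"
    by (rule order_tendstoD)
  then obtain M where M: "\<And>m. M \<le> m \<Longrightarrow> real K * ((t * C + E m / t) / 2) < \<epsilon>"
    by (auto simp: eventually_sequentially)
  obtain m where m: "max 1 M \<le> m" "A m \<le> \<epsilon>"
    using exists_small_A[OF \<epsilon>] by blast
  then have "1 \<le> m" "M \<le> m" by auto
  moreover have "\<bar>(\<integral>x. indicator B (X j x) \<partial>\<pi> (m * K)) - measure (\<nu> j) B\<bar> \<le> \<epsilon>"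
    if "j < K" "B \<in> sets N" for j B
    by (rule order_trans[OF marginal_error[OF \<open>1 \<le> m\<close> that t] less_imp_le[OF M[OF \<open>M \<le> m\<close>]]])
  ultimately show ?thesis
    using m(2) by blast
qed

lemma I_le_suminf_e: "I \<le> suminf e"
proof -
  interpret P: prob_space P by (rule prob_P)
  \<comment> \<open>One linear constraint per event \<open>X k \<in> B\<close>. Imposing all of them
    gives the limit density exactly the marginals \<open>\<nu> k\<close>, so that it competes with
    \<open>p\<close>.\<close>
  define J where "J = {(k, B). k < K \<and> B \<in> sets N}"
  define D where "D = (\<lambda>(k, B). X k -` B \<inter> space P)"
  have D: "D i \<in> sets P" if "i \<in> J" for i
    using that X by (auto simp: J_def D_def intro: measurable_sets)
  have "\<exists>f :: 'b \<Rightarrow> real. f \<in> borel_measurable P \<and> (\<forall>x. 0 \<le> f x) \<and>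
      integrable P f \<and> integral\<^sup>L P f = 1 \<and> integrable P (\<lambda>x. f x * ln (f x)) \<and>
      (\<integral>x. f x * ln (f x) \<partial>P) \<le> suminf e \<and>
      (\<forall>i\<in>J. (\<integral>x. f x * indicator (D i) x \<partial>P) = (case i of (k, B) \<Rightarrow> measure (\<nu> k) B))"
  proof (rule P.exists_entropy_limit[OF D])
    fix \<epsilon> :: real assume "0 < \<epsilon>"
    then obtain m where m: "1 \<le> m" and Am: "A m \<le> \<epsilon>"
      and near: "\<And>j B. j < K \<Longrightarrow> B \<in> sets N \<Longrightarrow>
        \<bar>(\<integral>x. indicator B (X j x) \<partial>\<pi> (m * K)) - measure (\<nu> j) B\<bar> \<le> \<epsilon>"
      using nearly_feasible by blast
    let ?f = "\<lambda>x. exp (H (m * K) x)"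
    have "\<bar>(\<integral>x. ?f x * indicator (D i) x \<partial>P) - (case i of (k, B) \<Rightarrow> measure (\<nu> k) B)\<bar> \<le> \<epsilon>" if "i \<in> J" for i
    proof -
      obtain k B where i: "i = (k, B)" "k < K" and B[measurable]: "B \<in> sets N"
        using \<open>i \<in> J\<close> by (auto simp: J_def)
      have [measurable]: "X k \<in> measurable P N" by (rule X[OF i(2)])
      have "(\<integral>x. indicator B (X k x) \<partial>\<pi> (m * K)) = (\<integral>x. ?f x * indicator B (X k x) \<partial>P)"
        by (subst \<pi>_density, subst integral_density) simp_all
      also have "\<dots> = (\<integral>x. ?f x * indicator (D i) x \<partial>P)"
        by (rule Bochner_Integration.integral_cong) (auto simp: D_def i indicator_def)
      finally show ?thesis
        using near[OF i(2) B] by (simp add: i)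
    qed
    moreover have "A m + (\<Sum>i<m * K. e i) \<le> suminf e + \<epsilon>"
      using Am sum_le_suminf[OF summable_e, of "{..<m * K}"] e_nonneg by simp
    ultimately show "\<exists>f :: 'b \<Rightarrow> real. f \<in> borel_measurable P \<and> (\<forall>x. 0 \<le> f x) \<and>
      integrable P f \<and> integral\<^sup>L P f = 1 \<and> integrable P (\<lambda>x. f x * ln (f x)) \<and>
      (\<integral>x. f x * ln (f x) \<partial>P) \<le> suminf e + \<epsilon> \<and>
      (\<forall>i\<in>J. \<bar>(\<integral>x. f x * indicator (D i) x \<partial>P) - (case i of (k, B) \<Rightarrow> measure (\<nu> k) B)\<bar> \<le> \<epsilon>)"
      using entropy_\<pi>[OF m] exp_H_int[of "m * K"]
      by (intro exI[of _ ?f] conjI ballI) (simp_all del: ln_exp)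
  qed
  then obtain f :: "'b \<Rightarrow> real" where f: "f \<in> borel_measurable P" "\<And>x. 0 \<le> f x" "integrable P f"
      "integral\<^sup>L P f = 1" "integrable P (\<lambda>x. f x * ln (f x))" "(\<integral>x. f x * ln (f x) \<partial>P) \<le> suminf e"
    and fD: "\<And>k B. k < K \<Longrightarrow> B \<in> sets N \<Longrightarrow> (\<integral>x. f x * indicator (D (k, B)) x \<partial>P) = measure (\<nu> k) B"
    unfolding J_def by auto
  have "distr (density P f) N (X k) = \<nu> k" if k: "k < K" for k
  proof (rule measure_eqI)
    interpret \<nu>: prob_space "\<nu> k" by (rule prob_\<nu>[OF k])
    fix B assume "B \<in> sets (distr (density P f) N (X k))"
    then have B: "B \<in> sets N" by simp
    have "emeasure (distr (density P f) N (X k)) B = emeasure (density P f) (D (k, B))"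
      using B X[OF k] by (subst emeasure_distr) (simp_all add: D_def)
    also have "\<dots> = ennreal (measure (\<nu> k) B)"
      using measure_density_real(2)[OF f(3,2) D, of "(k, B)"] B k fD[OF k B] by (simp add: J_def)
    finally show "emeasure (distr (density P f) N (X k)) B = emeasure (\<nu> k) B"
      by (simp add: \<nu>.emeasure_eq_measure)
  qed (simp add: sets_\<nu> k)
  then have "I \<le> (\<integral>x. f x * ln (f x) \<partial>P)"
    unfolding I_def using f by (intro p_minimal) auto
  then show ?thesis using f(6) by simp
qed

lemma L1_tendsto: "(\<lambda>n. \<integral>x. \<bar>exp (H n x) - p x\<bar> \<partial>P) \<longlonglongrightarrow> 0"
proof -
  have "suminf e = I" using I_le_suminf_e suminf_e_le by simp
  then have "(\<lambda>n. \<Sum>i<n. e i) \<longlonglongrightarrow> I"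
    using summable_LIMSEQ[OF summable_e] by simp
  then have "(\<lambda>n. 2 * sqrt (I - (\<Sum>i<n. e i))) \<longlonglongrightarrow> 2 * sqrt (I - I)"
    by (intro tendsto_intros)
  then have lim: "(\<lambda>n. 2 * sqrt (I - (\<Sum>i<n. e i))) \<longlonglongrightarrow> 0" by simp
  show ?thesis
    by (rule tendsto_sandwich[OF _ _ tendsto_const lim]) (simp_all add: L1_le)
qed

end

section \<open>Relative entropy, total variation and the first projection\<close>

lemma (in prob_space) exists_real_density:
  assumes \<rho>: "prob_space \<rho>" "absolutely_continuous M \<rho>" "sets \<rho> = sets M"
  obtains q :: "'a \<Rightarrow> real" where "q \<in> borel_measurable M" "\<And>x. 0 \<le> q x" "integrable M q" "integral\<^sup>L M q = 1"
    "\<rho> = density M q"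
proof -
  interpret \<rho>: prob_space \<rho> by (rule \<rho>(1))
  obtain q where q: "q \<in> borel_measurable M" "AE x in M. RN_deriv M \<rho> x = ennreal (q x)" "\<And>x. 0 \<le> q x"
    using real_RN_deriv[OF \<rho>.finite_measure_axioms \<rho>(2,3)] by metis
  have eq: "\<rho> = density M q"
    by (rule trans[OF density_RN_deriv[OF \<rho>(2,3), symmetric] density_cong[OF _ _ q(2)]])
      (use q(1) in measurable)
  have "(\<integral>\<^sup>+x. ennreal (q x) \<partial>M) = emeasure \<rho> (space \<rho>)"
    unfolding eq using q(1) by (subst emeasure_density) (auto intro!: nn_integral_cong)
  then have 1: "(\<integral>\<^sup>+x. ennreal (q x) \<partial>M) = 1"
    by (simp add: \<rho>.emeasure_space_1)
  then have int: "integrable M q"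
    using q by (intro integrableI_nonneg) auto
  then have "integral\<^sup>L M q = 1"
    using 1 q(3) by (simp add: nn_integral_eq_integral)
  then show thesis
    using that q int eq by blast
qed

lemma (in prob_space) KL_real_density:
  fixes q :: "'a \<Rightarrow> real"
  assumes q[measurable]: "q \<in> borel_measurable M" and q0: "\<And>x. 0 \<le> q x"
  shows "KL (density M q) M =
    (if integrable M (\<lambda>x. q x * ln (q x)) then ereal (\<integral>x. q x * ln (q x) \<partial>M) else \<infinity>)"
proof -
  have ln: "log (exp 1) = (ln :: real \<Rightarrow> real)"
    by (simp add: fun_eq_iff log_def)
  have "AE x in M. ennreal (q x) = RN_deriv M (density M q) x"
    by (rule RN_deriv_unique) simp_all
  then have ed: "AE x in M. entropy_density (exp 1) M (density M q) x = ln (q x)"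
  proof eventually_elim
    case (elim x)
    then have "RN_deriv M (density M q) x = ennreal (q x)" by simp
    then show ?case by (simp add: entropy_density_def ln q0)
  qed
  have "integrable (density M q) (entropy_density (exp 1) M (density M q)) \<longleftrightarrow>
      integrable M (\<lambda>x. q x * entropy_density (exp 1) M (density M q) x)"
    by (subst integrable_density) (simp_all add: q0)
  also have "\<dots> \<longleftrightarrow> integrable M (\<lambda>x. q x * ln (q x))"
  proof (rule integrable_cong_AE)
    show "AE x in M. q x * entropy_density (exp 1) M (density M q) x = q x * ln (q x)"
      using ed by eventually_elim simp
  qed simp_all
  finally have "integrable (density M q) (entropy_density (exp 1) M (density M q)) \<longleftrightarrow>
      integrable M (\<lambda>x. q x * ln (q x))" .
  moreover have "KL_divergence (exp 1) M (density M q) = (\<integral>x. q x * ln (q x) \<partial>M)"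
    by (subst KL_density) (simp_all add: q0 ln)
  moreover have "absolutely_continuous M (density M q)"
    by (rule absolutely_continuousI_density) simp
  ultimately show ?thesis
    by (simp add: KL_def)
qed

lemma KL_less_infinity_ac: "KL \<rho> M < \<infinity> \<Longrightarrow> absolutely_continuous M \<rho>"
  by (auto simp: KL_def split: if_splits)

section \<open>Total variation between two densities\<close>

lemma TV_norm_diff_density_le:
  fixes f g :: "'b \<Rightarrow> real"
  assumes f: "integrable M f" "\<And>x. 0 \<le> f x" and g: "integrable M g" "\<And>x. 0 \<le> g x"
  shows "0 \<le> TV_norm_diff (density M f) (density M g)"
    and "TV_norm_diff (density M f) (density M g) \<le> (\<integral>x. \<bar>f x - g x\<bar> \<partial>M)"
proof -
  let ?\<P> = "{P. finite P \<and> P \<subseteq> sets (density M f) \<and> partition_on (space (density M f)) P}"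
  let ?S = "\<lambda>P. \<Sum>B\<in>P. \<bar>measure (density M f) B - measure (density M g) B\<bar>"
  have d: "integrable M (\<lambda>x. \<bar>f x - g x\<bar>)" using f g by simp
  have one: "\<bar>measure (density M f) B - measure (density M g) B\<bar> \<le> measure (density M (\<lambda>x. \<bar>f x - g x\<bar>)) B"
    if B: "B \<in> sets M" for B
  proof -
    have ints: "integrable M (\<lambda>x. f x * indicator B x)" "integrable M (\<lambda>x. g x * indicator B x)"
      by (rule integrable_real_mult_indicator[OF B f(1)], rule integrable_real_mult_indicator[OF B g(1)])
    have "\<bar>measure (density M f) B - measure (density M g) B\<bar> = \<bar>\<integral>x. f x * indicator B x - g x * indicator B x \<partial>M\<bar>"
      by (simp only: measure_density_real(1)[OF f B] measure_density_real(1)[OF g B]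
          Bochner_Integration.integral_diff[OF ints])
    also have "\<dots> \<le> (\<integral>x. \<bar>f x * indicator B x - g x * indicator B x\<bar> \<partial>M)"
      by (rule integral_abs_bound)
    also have "\<dots> = (\<integral>x. \<bar>f x - g x\<bar> * indicator B x \<partial>M)"
      by (rule Bochner_Integration.integral_cong) (simp_all add: indicator_def)
    also have "\<dots> = measure (density M (\<lambda>x. \<bar>f x - g x\<bar>)) B"
      by (rule measure_density_real(1)[OF d _ B, symmetric]) simp
    finally show ?thesis .
  qed
  have le: "?S P \<le> (\<integral>x. \<bar>f x - g x\<bar> \<partial>M)" if "P \<in> ?\<P>" for P
  proof -
    have P: "finite P" "P \<subseteq> sets M" "\<Union>P = space M" "disjoint P"
      using that by (auto simp: partition_on_def)
    have em: "emeasure (density M (\<lambda>x. \<bar>f x - g x\<bar>)) (space M) \<noteq> \<infinity>"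
      using measure_density_real(2)[OF d _ sets.top] by simp
    interpret D: finite_measure "density M (\<lambda>x. \<bar>f x - g x\<bar>)"
      by standard (use em in simp)
    have "?S P \<le> (\<Sum>B\<in>P. measure (density M (\<lambda>x. \<bar>f x - g x\<bar>)) B)"
      using P by (intro sum_mono one) auto
    also have "\<dots> = measure (density M (\<lambda>x. \<bar>f x - g x\<bar>)) (\<Union>B\<in>P. B)"
      using P by (intro D.finite_measure_finite_Union[symmetric])
        (auto simp: disjoint_family_on_def disjoint_def)
    also have "(\<Union>B\<in>P. B) = space M" using P(3) by simp
    also have "measure (density M (\<lambda>x. \<bar>f x - g x\<bar>)) (space M) = (\<integral>x. \<bar>f x - g x\<bar> * indicator (space M) x \<partial>M)"
      by (rule measure_density_real(1)[OF d]) auto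
    also have "\<dots> = (\<integral>x. \<bar>f x - g x\<bar> \<partial>M)"
      by (rule Bochner_Integration.integral_cong) simp_all
    finally show ?thesis .
  qed
  \<comment> \<open>A supremum of reals is meaningful only over a nonempty set, so some partition is
    exhibited; the empty set is not an admissible block.\<close>
  have "(if space M = {} then {} else {space M}) \<in> ?\<P>"
    by (auto simp: partition_on_def disjoint_def)
  then obtain P where P: "P \<in> ?\<P>" by blast
  show "TV_norm_diff (density M f) (density M g) \<le> (\<integral>x. \<bar>f x - g x\<bar> \<partial>M)"
    unfolding TV_norm_diff_def using P le by (intro cSUP_least) auto
  have "bdd_above (?S ` ?\<P>)"
    using le by (intro bdd_aboveI2)
  then have "?S P \<le> (SUP P\<in>?\<P>. ?S P)"
    using P by (intro cSUP_upper)
  moreover have "0 \<le> ?S P" by (rule sum_nonneg) simp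
  ultimately show "0 \<le> TV_norm_diff (density M f) (density M g)"
    unfolding TV_norm_diff_def by linarith
qed

text \<open>The competitor is the reweighting of \<open>M\<close> by the density of the marginal of \<open>density M (exp h)\<close>
  with respect to the marginal of \<open>M\<close>; minimality forces the relative entropy of
  \<open>density M (exp h)\<close> with respect to it to vanish.\<close>

lemma (in prob_space) entropy_minimal_imp_marginal_density:
  fixes h :: "'a \<Rightarrow> real" and N :: "'c measure"
  defines "\<rho> \<equiv> density M (\<lambda>x. ennreal (exp (h x)))"
  assumes X[measurable]: "X \<in> measurable M N" and h[measurable]: "h \<in> borel_measurable M"
    and \<rho>: "prob_space \<rho>" "integrable \<rho> h"
    and minimal: "\<And>w :: 'a \<Rightarrow> real. \<lbrakk>w \<in> borel_measurable M; prob_space (density M (\<lambda>x. ennreal (exp (w x))));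
      distr (density M (\<lambda>x. ennreal (exp (w x)))) N X = distr \<rho> N X;
      integrable (density M (\<lambda>x. ennreal (exp (w x)))) w\<rbrakk>
      \<Longrightarrow> (\<integral>x. h x \<partial>\<rho>) \<le> (\<integral>x. w x \<partial>density M (\<lambda>x. ennreal (exp (w x))))"
  shows "\<exists>v\<in>borel_measurable N. AE x in M. h x = v (X x)"
proof -
  interpret \<rho>: prob_space \<rho> by (rule \<rho>(1))
  define R where "R = distr M N X"
  define \<nu> where "\<nu> = distr \<rho> N X"
  have sets_\<rho>: "sets \<rho> = sets M" and meas_\<rho>[simp]: "\<And>L. measurable \<rho> L = measurable M L"
    by (auto simp: \<rho>_def)
  interpret R: prob_space R unfolding R_def by (rule prob_space_distr) simp
  interpret \<nu>: prob_space \<nu> unfolding \<nu>_def by (rule \<rho>.prob_space_distr) simp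
  have sets_R[simp, measurable_cong]: "sets R = sets N" and sets_\<nu>[simp, measurable_cong]: "sets \<nu> = sets N"
    by (simp_all add: R_def \<nu>_def)
  have meas_R[simp]: "measurable R L = measurable N L" for L
    by (rule measurable_cong_sets) simp_all
  have AE_\<rho>: "(AE x in \<rho>. Q x) \<longleftrightarrow> (AE x in M. Q x)" for Q
    unfolding \<rho>_def by (subst AE_density) auto
  have AE_\<nu>: "(AE y in \<nu>. Q y) \<longleftrightarrow> (AE y in R. Q y)" if "{y \<in> space N. Q y} \<in> sets N" for Q
    unfolding \<nu>_def R_def using that by (simp add: AE_distr_iff AE_\<rho>)
  have ac: "absolutely_continuous R \<nu>"
    unfolding absolutely_continuous_def
  proof
    fix B assume B: "B \<in> null_sets R"
    then have "AE y in R. y \<notin> B" by (rule AE_not_in)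
    moreover have "B \<in> sets N" using B by auto
    ultimately have "AE y in \<nu>. y \<notin> B" by (subst AE_\<nu>) auto
    then show "B \<in> null_sets \<nu>"
      using \<open>B \<in> sets N\<close> by (simp add: AE_iff_null_sets)
  qed
  obtain u :: "'c \<Rightarrow> real" where u: "u \<in> borel_measurable R" "\<And>x. 0 \<le> u x" "\<nu> = density R u"
    by (rule R.exists_real_density[OF \<nu>.prob_space_axioms ac sets_\<nu>[folded sets_R]]) (rule that)
  note u(1)[simplified, measurable]
  define v where "v y = ln (u y)" for y
  have v[measurable]: "v \<in> borel_measurable N" unfolding v_def by measurable
  \<comment> \<open>Positivity transfers from \<open>\<nu>\<close> to \<open>R\<close>: the two have
    the same null sets because \<open>exp h\<close> never vanishes. Hence \<open>exp v\<close>
    recovers \<open>u\<close>.\<close>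
  have "AE y in density R u. 0 < u y"
    using u by (subst AE_density) (auto simp: ennreal_less_zero_iff)
  then have "AE y in R. 0 < u y"
    unfolding u(3)[symmetric] by (subst (asm) AE_\<nu>) auto
  then have "AE y in R. ennreal (u y) = ennreal (exp (v y))"
    by eventually_elim (simp add: v_def)
  then have \<nu>_eq: "\<nu> = density R (\<lambda>y. ennreal (exp (v y)))"
    unfolding u(3) by (intro density_cong) simp_all
  define w where "w x = v (X x)" for x
  have w[measurable]: "w \<in> borel_measurable M" unfolding w_def by measurable
  define \<sigma> where "\<sigma> = density M (\<lambda>x. ennreal (exp (w x)))"
  have \<sigma>_marg: "distr \<sigma> N X = \<nu>"
    unfolding \<nu>_eq R_def \<sigma>_def w_def by (rule density_distr[symmetric]) simp_all
  have \<sigma>_prob: "prob_space \<sigma>"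
  proof (rule prob_spaceI)
    have "emeasure \<sigma> (space \<sigma>) = emeasure (distr \<sigma> N X) (space N)"
      by (subst emeasure_distr) (auto simp: \<sigma>_def intro!: arg_cong[where f="emeasure _"] dest: measurable_space[OF X])
    then show "emeasure \<sigma> (space \<sigma>) = 1"
      using \<nu>.emeasure_space_1 sets_eq_imp_space_eq[OF sets_\<nu>] by (simp add: \<sigma>_marg)
  qed
  interpret \<sigma>: prob_space \<sigma> by (rule \<sigma>_prob)
  have exp_w: "integrable M (\<lambda>x. exp (w x))" "(\<integral>x. exp (w x) \<partial>M) = 1"
  proof -
    have "integrable \<sigma> (\<lambda>_. 1 :: real)"
      by simp
    then show "integrable M (\<lambda>x. exp (w x))"
      unfolding \<sigma>_def by (subst (asm) integrable_density) simp_all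
    have "(\<integral>x. 1 \<partial>\<sigma>) = (1 :: real)"
      using \<sigma>.prob_space by simp
    then show "(\<integral>x. exp (w x) \<partial>M) = 1"
      unfolding \<sigma>_def by (subst (asm) integral_density) simp_all
  qed
  have exp_v: "integrable \<nu> (\<lambda>y. exp (- v y))"
    unfolding \<nu>_eq by (subst integrable_density) (simp_all flip: exp_add)
  have i1: "integrable \<rho> (\<lambda>x. exp (- w x))"
    using exp_v unfolding \<nu>_def w_def by (subst (asm) integrable_distr_eq) simp_all
  have g: "integrable \<rho> (\<lambda>x. exp (w x - h x))" "(\<integral>x. exp (w x - h x) \<partial>\<rho>) = 1"
    unfolding \<rho>_def using exp_w by (simp_all add: integrable_density integral_density flip: exp_add)
  \<comment> \<open>\<open>w\<close> lies between \<open>1 - exp (- w)\<close> and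
    \<open>h - 1 + exp (w - h)\<close>, all of whose terms are integrable under
    \<open>\<rho>\<close>.\<close>
  have w_\<rho>: "integrable \<rho> w"
  proof (rule Bochner_Integration.integrable_bound)
    show "integrable \<rho> (\<lambda>x. exp (- w x) + \<bar>h x\<bar> + exp (w x - h x))"
      by (intro Bochner_Integration.integrable_add integrable_abs i1 g \<rho>(2))
    show "AE x in \<rho>. norm (w x) \<le> norm (exp (- w x) + \<bar>h x\<bar> + exp (w x - h x))"
    proof (rule AE_I2)
      fix x
      show "norm (w x) \<le> norm (exp (- w x) + \<bar>h x\<bar> + exp (w x - h x))"
        using exp_ge_add_one_self[of "- w x"] exp_ge_add_one_self[of "w x - h x"]
          exp_gt_zero[of "- w x"] exp_gt_zero[of "w x - h x"] unfolding real_norm_def by linarith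
    qed
  qed simp
  have w_\<nu>: "integrable \<nu> v"
    using w_\<rho> unfolding \<nu>_def w_def by (subst integrable_distr_eq) simp_all
  have w_\<sigma>: "integrable \<sigma> w"
    using w_\<nu> unfolding \<sigma>_marg[symmetric] w_def by (subst (asm) integrable_distr_eq) (simp_all add: \<sigma>_def)
  \<comment> \<open>Minimality compares integrals under two different measures; since
    \<open>w\<close> depends on \<open>X\<close> only and both have the same marginal, its integral
    can be moved to \<open>\<rho>\<close>.\<close>
  have "(\<integral>x. h x \<partial>\<rho>) \<le> (\<integral>x. w x \<partial>\<sigma>)"
    unfolding \<sigma>_def using \<sigma>_prob \<sigma>_marg w_\<sigma> unfolding \<sigma>_def \<nu>_def by (intro minimal) simp_all
  also have "\<dots> = (\<integral>y. v y \<partial>\<nu>)"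
    unfolding \<sigma>_marg[symmetric] w_def by (rule integral_distr[symmetric]) (simp_all add: \<sigma>_def)
  also have "\<dots> = (\<integral>x. w x \<partial>\<rho>)"
    unfolding \<nu>_def w_def by (rule integral_distr) simp_all
  finally have le: "(\<integral>x. h x \<partial>\<rho>) \<le> (\<integral>x. w x \<partial>\<rho>)" .
  \<comment> \<open>A pointwise nonnegative integrand for the relative entropy of
    \<open>\<rho>\<close> with respect to \<open>\<sigma>\<close>, which vanishes only where
    \<open>w = h\<close>.\<close>
  let ?k = "\<lambda>x. exp (w x - h x) - 1 - (w x - h x)"
  have k_int: "integrable \<rho> ?k"
    by (intro Bochner_Integration.integrable_diff g w_\<rho> \<rho>(2) \<rho>.integrable_const)
  have k0: "0 \<le> ?k x" for x
    using exp_ge_add_one_self[of "w x - h x"] by linarith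
  have "(\<integral>x. ?k x \<partial>\<rho>) = (\<integral>x. h x \<partial>\<rho>) - (\<integral>x. w x \<partial>\<rho>)"
    using g w_\<rho> \<rho>(2) \<rho>.prob_space by simp
  moreover have "0 \<le> (\<integral>x. ?k x \<partial>\<rho>)"
    by (rule Bochner_Integration.integral_nonneg) (rule k0)
  ultimately have "(\<integral>x. ?k x \<partial>\<rho>) = 0" using le by simp
  then have "AE x in \<rho>. ?k x = 0"
    using k_int k0 by (subst (asm) integral_nonneg_eq_0_iff_AE) simp_all
  then have "AE x in \<rho>. h x = w x"
  proof eventually_elim
    case (elim x)
    then have "(sqrt (exp (w x - h x)) - 1)\<^sup>2 \<le> 0"
      using sqrt_minus_one_sq_le[of "exp (w x - h x)"] by simp
    then have "sqrt (exp (w x - h x)) = 1" by simp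
    then show ?case by simp
  qed
  then have "AE x in M. h x = v (X x)"
    unfolding AE_\<rho> w_def .
  then show ?thesis using v by blast
qed

text \<open>Step \<open>n\<close> replaces one potential, that of coordinate \<open>n mod K\<close>,
  by its next generation. When \<open>k + 1 = K\<close> a new cycle begins, and the sum over old
  generations restarts from all but coordinate 0.\<close>

lemma potential_sum_Suc:
  fixes \<phi> :: "nat \<Rightarrow> nat \<Rightarrow> real"
  assumes K: "0 < K" and n: "1 \<le> n"
  shows "(\<Sum>j\<in>{0..n mod K}. \<phi> (n div K + 1) j) + (\<Sum>j\<in>{n mod K + 1..<K}. \<phi> (n div K) j) =
    (\<Sum>j\<in>{0..(n - 1) mod K}. \<phi> ((n - 1) div K + 1) j) + (\<Sum>j\<in>{(n - 1) mod K + 1..<K}. \<phi> ((n - 1) div K) j)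
    + (\<phi> (n div K + 1) (n mod K) - \<phi> (n div K) (n mod K))"
proof -
  define q k where "q = (n - 1) div K" and "k = (n - 1) mod K"
  have k: "k < K" using K by (simp add: k_def)
  have n_eq: "n = q * K + k + 1"
    using div_mult_mod_eq[of "n - 1" K] n by (simp add: q_def k_def)
  show ?thesis
  proof (cases "k + 1 < K")
    case True
    have "n = (k + 1) + q * K" using n_eq by simp
    then have "n div K = q" "n mod K = k + 1"
      using True by (simp_all only: div_mult_self1 mod_mult_self1) simp_all
    moreover have "{k + 1..<K} = insert (k + 1) {k + 1 + 1..<K}" using True by auto
    moreover have "{0..k + 1} = insert (k + 1) {0..k}" by auto
    ultimately show ?thesis
      unfolding q_def[symmetric] k_def[symmetric] by simp
  next
    case False
    then have kK: "k + 1 = K" using k by simp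
    then have "n = (q + 1) * K" using n_eq by simp
    then have "n div K = q + 1" "n mod K = 0" using K by simp_all
    moreover have "{0..k} = insert 0 {1..<K}" "{k + 1..<K} = {}" using kK by auto
    ultimately show ?thesis
      unfolding q_def[symmetric] k_def[symmetric] by simp
  qed
qed

theorem proposition6:
  fixes l K :: nat
    and S :: "nat set"
    and \<iota> :: "nat \<Rightarrow> nat"
    and \<pi>0 \<pi>star :: "(nat \<Rightarrow> real ^ 'd) measure"
    and \<mu> :: "nat \<Rightarrow> (real ^ 'd) measure"
    and \<pi> :: "nat \<Rightarrow> (nat \<Rightarrow> real ^ 'd) measure"
    and \<psi> :: "nat \<Rightarrow> nat \<Rightarrow> real ^ 'd \<Rightarrow> real"
  assumes K: "0 < K"
    and S: "S = \<iota> ` {..<K}" "S \<subseteq> {0..l}" "card S = K"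
    and \<pi>0: "\<pi>0 \<in> prob_measures (path_space l)"
    and \<mu>: "\<forall>i\<in>S. \<mu> i \<in> prob_measures borel"
    and A2: "\<exists>\<nu> h r.
      (\<forall>i\<in>{0..l}. sets (\<nu> i) = sets borel \<and> sigma_finite_measure (\<nu> i)) \<and>
      absolutely_continuous (Pi\<^sub>M {0..l} \<nu>) \<pi>0 \<and>
      h \<in> borel_measurable (Pi\<^sub>M {0..l} \<nu>) \<and> \<pi>0 = density (Pi\<^sub>M {0..l} \<nu>) h \<and>
      (\<forall>i\<in>S. absolutely_continuous (\<nu> i) (\<mu> i) \<and>
        r i \<in> borel_measurable (\<nu> i) \<and> \<mu> i = density (\<nu> i) (r i))"
    and A3: "{\<rho> \<in> with_marginals l S \<mu>. KL \<rho> \<pi>0 < \<infinity>} \<noteq> {}"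
    and A4: "\<exists>\<mu>t. (\<forall>j\<in>{0..l} - S. \<mu>t j \<in> prob_measures borel) \<and>
      (let \<pi>t = Pi\<^sub>M {0..l} (\<lambda>i. if i \<in> S then \<mu> i else \<mu>t i) in
        absolutely_continuous \<pi>t \<pi>0 \<and> absolutely_continuous \<pi>0 \<pi>t)"
    and \<pi>star: "is_KL_projection (with_marginals l S \<mu>) \<pi>0 \<pi>star"
    and mIPF: "mIPF_sequence l K \<iota> \<mu> \<pi>0 \<pi>"
    and potentials: "mIPF_potentials K \<iota> \<pi> \<psi>"
    and A5: "L1_closed \<pi>star (L1_direct_sum S \<mu>)"
    and A6: "\<exists>c>0. \<forall>n k x. k + 1 < K \<longrightarrow> exp (\<psi> n (\<iota> k) x - \<psi> (n + 1) (\<iota> k) x) \<le> c"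
  shows "(\<lambda>n. TV_norm_diff (\<pi> n) \<pi>star) \<longlonglongrightarrow> 0"
proof -
  interpret P: prob_space \<pi>0
    using \<pi>0 by (simp add: prob_measures_def)
  define X where "X k x = x (\<iota> k)" for k and x :: "nat \<Rightarrow> real ^ 'd"
  have sets_\<pi>0: "sets \<pi>0 = sets (path_space l)"
    using \<pi>0 by (simp add: prob_measures_def)
  have X_path: "X k \<in> measurable (path_space l) borel" if "k < K" for k
    unfolding X_def[abs_def] path_space_def using that S by (intro measurable_component_singleton) auto
  have X_meas: "X k \<in> measurable \<pi>0 borel" if "k < K" for k
    using X_path[OF that] by (subst measurable_cong_sets[OF sets_\<pi>0 refl])
  have X_mod[measurable]: "X (n mod K) \<in> measurable \<pi>0 borel" for n
    using K by (intro X_meas) simp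
  have marginal_X: "marginal (\<iota> k) \<rho> = distr \<rho> borel (X k)" for k \<rho>
    by (simp add: marginal_def X_def[abs_def])
  have \<pi>_0: "\<pi> 0 = \<pi>0"
    using mIPF by (simp add: mIPF_sequence_def)
  have proj: "is_KL_projection (with_marginals l {\<iota> (n mod K)} \<mu>) (\<pi> n) (\<pi> (Suc n))" for n
    using mIPF by (simp add: mIPF_sequence_def)
  have \<pi>_in: "\<pi> (Suc n) \<in> with_marginals l {\<iota> (n mod K)} \<mu>" for n
    using proj[of n] by (simp add: is_KL_projection_def is_arg_min_def)
  have \<pi>_pm: "\<pi> n \<in> prob_measures (path_space l)" for n
    using \<pi>_in[of "n - 1"] \<pi>0 \<pi>_0 by (cases n) (auto simp: with_marginals_def)
  have prob_\<pi>: "prob_space (\<pi> n)" for n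
    using \<pi>_pm[of n] by (simp add: prob_measures_def)
  have marg_\<pi>: "distr (\<pi> (Suc n)) borel (X (n mod K)) = \<mu> (\<iota> (n mod K))" for n
    using \<pi>_in[of n] by (simp add: with_marginals_def marginal_X)

  have star_in: "\<pi>star \<in> with_marginals l S \<mu>"
    using \<pi>star by (simp add: is_KL_projection_def is_arg_min_def)
  have star_min: "KL \<pi>star \<pi>0 \<le> KL \<rho> \<pi>0" if "\<rho> \<in> with_marginals l S \<mu>" for \<rho>
    using \<pi>star that by (auto simp: is_KL_projection_def is_arg_min_def not_less)
  have star_fin: "KL \<pi>star \<pi>0 < \<infinity>"
    using A3 star_min by (auto intro: le_less_trans)
  have star: "prob_space \<pi>star" "sets \<pi>star = sets \<pi>0"
    using star_in sets_\<pi>0 by (simp_all add: with_marginals_def prob_measures_def)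
  obtain p :: "(nat \<Rightarrow> real ^ 'd) \<Rightarrow> real" where star_dens: "p \<in> borel_measurable \<pi>0" "\<And>x. 0 \<le> p x"
      "integrable \<pi>0 p" "integral\<^sup>L \<pi>0 p = 1" "\<pi>star = density \<pi>0 p"
    by (rule P.exists_real_density[OF star(1) KL_less_infinity_ac[OF star_fin] star(2)]) (rule that)
  have KL_star: "integrable \<pi>0 (\<lambda>x. p x * ln (p x))"
      "KL \<pi>star \<pi>0 = ereal (\<integral>x. p x * ln (p x) \<partial>\<pi>0)"
    using star_fin P.KL_real_density[OF star_dens(1,2)] by (auto simp: star_dens(5) split: if_splits)

  define h where "h n x =
      (\<Sum>j\<in>{0..(n - 1) mod K}. \<psi> ((n - 1) div K + 1) (\<iota> j) (X j x)) +
      (\<Sum>j\<in>{(n - 1) mod K + 1..<K}. \<psi> ((n - 1) div K) (\<iota> j) (X j x))" for n x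
  have \<psi>_borel: "\<psi> m (\<iota> j) \<in> borel_measurable borel" if "j < K" for m j
    using potentials that by (auto simp: mIPF_potentials_def)
  have \<psi>_meas: "(\<lambda>x. \<psi> m (\<iota> j) (X j x)) \<in> borel_measurable \<pi>0" if "j < K" for m j
    by (rule measurable_compose[OF X_meas[OF that] \<psi>_borel[OF that]])
  have h_meas[measurable]: "h n \<in> borel_measurable \<pi>0" for n
    unfolding h_def using mod_less_divisor[OF K, of "n - 1"]
    by (intro borel_measurable_add borel_measurable_sum \<psi>_meas) auto
  have \<pi>_dens: "\<pi> n = density \<pi>0 (\<lambda>x. ennreal (exp (h n x)))" if n: "1 \<le> n" for n
  proof -
    have AE: "AE x in \<pi>0. RN_deriv \<pi>0 (\<pi> n) x = ennreal (exp (h n x))"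
      using potentials n unfolding mIPF_potentials_def Let_def h_def X_def \<pi>_0 by blast
    \<comment> \<open>Without a density \<open>RN_deriv\<close> would be 0 by default, contradicting
      its equality with a positive exponential.\<close>
    have "\<exists>f. f \<in> borel_measurable \<pi>0 \<and> density \<pi>0 f = \<pi> n"
    proof (rule ccontr)
      assume "\<not> ?thesis"
      then have "RN_deriv \<pi>0 (\<pi> n) = (\<lambda>_. 0)"
        unfolding RN_deriv_def by (rule if_not_P)
      then have "AE x in \<pi>0. False"
        using AE by (simp add: ennreal_eq_0_iff)
      then show False by simp
    qed
    then have "density \<pi>0 (RN_deriv \<pi>0 (\<pi> n)) = \<pi> n"
      using RN_derivI by blast
    then have "\<pi> n = density \<pi>0 (RN_deriv \<pi>0 (\<pi> n))" ..
    also have "\<dots> = density \<pi>0 (\<lambda>x. ennreal (exp (h n x)))"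
      by (rule density_cong[OF _ _ AE]) measurable
    finally show ?thesis .
  qed

  \<comment> \<open>The function \<open>h 1\<close> may contain \<open>\<psi> 0\<close> at
    coordinates other than the first; minimality of the first projection shows that it is
    nevertheless a function of \<open>X 0\<close> almost everywhere.\<close>
  have "\<exists>v\<in>borel_measurable borel. AE x in \<pi>0. h 1 x = v (X (0 mod K) x)"
  proof (rule P.entropy_minimal_imp_marginal_density)
    let ?\<rho> = "density \<pi>0 (\<lambda>x. ennreal (exp (h 1 x)))"
    have \<rho>: "?\<rho> = \<pi> 1" using \<pi>_dens[of 1] by simp
    have first_min: "KL (\<pi> 1) \<pi>0 \<le> KL \<tau> \<pi>0" if "\<tau> \<in> with_marginals l {\<iota> (0 mod K)} \<mu>" for \<tau>
      using proj[of 0] that by (auto simp: is_KL_projection_def is_arg_min_def not_less \<pi>_0)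
    \<comment> \<open>\<open>\<pi>star\<close> competes in the first projection, so its finite
      entropy makes \<open>h 1\<close> integrable under \<open>\<pi> 1\<close>.\<close>
    have "\<pi>star \<in> with_marginals l {\<iota> (0 mod K)} \<mu>"
      using star_in K S(1) by (auto simp: with_marginals_def)
    then have fin: "KL (\<pi> 1) \<pi>0 < \<infinity>"
      using first_min star_fin by (meson le_less_trans)
    have KL_exp: "KL (density \<pi>0 (\<lambda>x. ennreal (exp (w x)))) \<pi>0 =
        (if integrable (density \<pi>0 (\<lambda>x. ennreal (exp (w x)))) w
         then ereal (\<integral>x. w x \<partial>density \<pi>0 (\<lambda>x. ennreal (exp (w x)))) else \<infinity>)"
      if [measurable]: "w \<in> borel_measurable \<pi>0" for w
      using P.KL_real_density[of "\<lambda>x. exp (w x)"]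
      by (simp add: integrable_density integral_density)
    show "prob_space ?\<rho>" unfolding \<rho> by (rule prob_\<pi>)
    show int: "integrable ?\<rho> (h 1)"
      using fin KL_exp[OF h_meas, of 1] unfolding \<rho> by (auto split: if_splits)
    fix w :: "(nat \<Rightarrow> real ^ 'd) \<Rightarrow> real"
    let ?\<tau> = "density \<pi>0 (\<lambda>x. ennreal (exp (w x)))"
    assume w: "w \<in> borel_measurable \<pi>0" "prob_space ?\<tau>"
      "distr ?\<tau> borel (X (0 mod K)) = distr ?\<rho> borel (X (0 mod K))" "integrable ?\<tau> w"
    have "?\<tau> \<in> with_marginals l {\<iota> (0 mod K)} \<mu>"
      using w(2,3) marg_\<pi>[of 0] sets_\<pi>0 unfolding \<rho>
      by (simp add: with_marginals_def prob_measures_def marginal_X)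
    from first_min[OF this] show "(\<integral>x. h 1 x \<partial>?\<rho>) \<le> (\<integral>x. w x \<partial>?\<tau>)"
      using KL_exp[OF h_meas, of 1] KL_exp[OF w(1)] int w(4)
      unfolding \<rho> by simp
  qed (rule X_mod h_meas)+
  then obtain v :: "real ^ 'd \<Rightarrow> real" where v[measurable]: "v \<in> borel_measurable borel"
    and hv: "AE x in \<pi>0. h 1 x = v (X (0 mod K) x)"
    by blast
  define d where "d n = (if n = 0 then v
      else (\<lambda>y. \<psi> (n div K + 1) (\<iota> (n mod K)) y - \<psi> (n div K) (\<iota> (n mod K)) y))" for n
  have d_meas: "d n \<in> borel_measurable borel" for n
    using K by (auto simp: d_def intro!: borel_measurable_diff \<psi>_borel)
  have d_X[measurable]: "(\<lambda>x. d n (X (n mod K) x)) \<in> borel_measurable \<pi>0" for n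
    by (rule measurable_compose[OF X_mod d_meas])
  have \<pi>_Suc: "\<pi> (Suc n) = density (\<pi> n) (\<lambda>x. ennreal (exp (d n (X (n mod K) x))))" for n
  proof (cases "n = 0")
    case True
    have "AE x in \<pi>0. ennreal (exp (h 1 x)) = ennreal (exp (d 0 (X (0 mod K) x)))"
      using hv by eventually_elim (simp add: d_def)
    then have "density \<pi>0 (\<lambda>x. ennreal (exp (h 1 x))) = density \<pi>0 (\<lambda>x. ennreal (exp (d 0 (X (0 mod K) x))))"
      by (intro density_cong) measurable
    then show ?thesis
      using \<pi>_dens[of 1] True by (simp add: \<pi>_0)
  next
    case False
    then have n: "1 \<le> n" by simp
    have hS: "h (Suc n) x = h n x + d n (X (n mod K) x)" for x
      using potential_sum_Suc[OF K n, of "\<lambda>m j. \<psi> m (\<iota> j) (X j x)"] False by (simp add: h_def d_def)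
    have "density (\<pi> n) (\<lambda>x. ennreal (exp (d n (X (n mod K) x)))) =
        density \<pi>0 (\<lambda>x. ennreal (exp (h n x)) * ennreal (exp (d n (X (n mod K) x))))"
      unfolding \<pi>_dens[OF n] by (rule density_density_eq) measurable
    also have "\<dots> = density \<pi>0 (\<lambda>x. ennreal (exp (h (Suc n) x)))"
      by (simp add: hS exp_add ennreal_mult)
    also have "\<dots> = \<pi> (Suc n)"
      by (rule \<pi>_dens[symmetric]) simp
    finally show ?thesis ..
  qed
  obtain c where c: "\<And>n k x. k + 1 < K \<Longrightarrow> exp (\<psi> n (\<iota> k) x - \<psi> (n + 1) (\<iota> k) x) \<le> c"
    using A6 by blast

  \<comment> \<open>For \<open>n \<ge> 1\<close> the function \<open>exp (- d n)\<close> is the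
    quotient bounded in (A6) at generation \<open>n div K\<close>; the maximum with 1 makes the
    powers of the constant increasing.\<close>
  interpret cyclic_fitting \<pi>0 borel K X "\<lambda>k. \<mu> (\<iota> k)" d \<pi> p "max 1 c"
  proof (rule cyclic_fitting.intro)
    show "exp (- d n y) \<le> max 1 c" if "1 \<le> n" "n mod K + 1 < K" for n y
      using c[OF that(2), of "n div K" y] that(1) by (simp add: d_def max.coboundedI2)
    show "distr (density \<pi>0 p) borel (X k) = \<mu> (\<iota> k)" if "k < K" for k
      using star_in that S(1) unfolding star_dens(5)[symmetric] by (simp add: with_marginals_def marginal_X)
    fix q :: "(nat \<Rightarrow> real ^ 'd) \<Rightarrow> real"
    assume q: "q \<in> borel_measurable \<pi>0" "\<And>x. 0 \<le> q x" "integrable \<pi>0 q" "integral\<^sup>L \<pi>0 q = 1"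
      "integrable \<pi>0 (\<lambda>x. q x * ln (q x))"
      "\<And>k. k < K \<Longrightarrow> distr (density \<pi>0 q) borel (X k) = \<mu> (\<iota> k)"
    have "density \<pi>0 q \<in> with_marginals l S \<mu>"
      using prob_space_density_real[OF q(3,2,4)] q(6) sets_\<pi>0
      by (auto simp: with_marginals_def prob_measures_def marginal_X S(1))
    from star_min[OF this] show "(\<integral>x. p x * ln (p x) \<partial>\<pi>0) \<le> (\<integral>x. q x * ln (q x) \<partial>\<pi>0)"
      using KL_star(2) P.KL_real_density[OF q(1,2)] q(5) by simp
  qed (assumption | rule K X_meas prob_\<pi> \<pi>_0 d_meas \<pi>_Suc marg_\<pi> star_dens KL_star(1) max.cobounded1)+

  note TV = TV_norm_diff_density_le[OF exp_H_int(1) _ star_dens(3,2), folded \<pi>_density star_dens(5)]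
  show ?thesis
    by (rule tendsto_sandwich[OF always_eventually[OF allI] always_eventually[OF allI] tendsto_const L1_tendsto])
      (rule TV, simp)+
qed

end
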